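(* Let $\mathcal Q^\circ$ be a set of alternative distributions such that for some $s>2$ $$\sup_{Q\in\mathcal Q^\circ}\mathbb E_Q\left|\log(\lambda_Q^\top\mathbf E_1)-\ell_Q^\star\right|^s<\infty,$$ and such that there exists $\underline\ell(\mathcal Q^\circ)>0$ with $\inf_{Q\in\mathcal Q^\circ}\ell_Q^\star\ge\underline\ell(\mathcal Q^\circ)$. Then for any $\mathcal P$-$e$-process $(W_n)$ with sublinear portfolio regret, the rejection time $\tau_\alpha:=\inf\{n\in\mathbb N:W_n\ge1/\alpha\}$ satisfies $$\limsup_{\alpha\to0^+}\sup_{Q\in\mathcal Q^\circ}\frac{\mathbb E_Q[\tau_\alpha]}{\log(1/\alpha)}\le\frac1{\underline\ell(\mathcal Q^\circ)}.$$ Finally, if moreover $\sup_{Q\in\mathcal Q^\circ}\ell_Q^\star\le\bar\ell(\mathcal Q^\circ)$ for some $\bar\ell(\mathcal Q^\circ)<\infty$, then for any $\alpha\in(0,1)$ and any stopping time $\tau_\alpha'$ with $\sup_{P\in\mathcal P}P(\tau_\alpha'<\infty)\le\alpha$, and any $Q\in\mathcal Q^\circ$, $$\frac{\mathbb E_Q[\tau_\alpha']}{\log(1/\alpha)}\ge\frac1{\bar\ell(\mathcal Q^\circ)}.$$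
   Context: Fix $d\in\mathbb N$ and let $\triangle_d=\{\lambda\in[0,1]^{d+1}:\sum_{j=0}^d\lambda^{(j)}=1\}$. Let $(\mathbf E_n)_{n=1}^\infty$, $\mathbf E_n=(E_n^{(0)},\dots,E_n^{(d)})$, be random vectors with values in $[0,\infty)^{d+1}$ such that $E_n^{(0)}=1$ deterministically; the coordinates of $\mathbf E_n$ may be arbitrarily dependent. Let $\mathcal F_n=\sigma(\mathbf E_1,\dots,\mathbf E_n)$, with $\mathcal F_0$ trivial; stopping times are $\mathbb N\cup\{\infty\}$-valued with $\{\tau=n\}\in\mathcal F_n$. Under every distribution considered, $(\mathbf E_n)$ is i.i.d. Null hypothesis: $\mathcal P$ is the set of all distributions $P$ (making $(\mathbf E_n)$ i.i.d.) with $\mathbb E_P[E_1^{(j)}]\le 1$ for each $j\in\{1,\dots,d\}$. An alternative distribution is a distribution $Q$ under which $(\mathbf E_n)$ is i.i.d. A test $P$-supermartingale is a nonnegative adapted process $(M_n)$ with $\mathbb E_P[M_n\mid\mathcal F_{n-1}]\le M_{n-1}$ $P$-a.s. for $n\ge2$ and $\mathbb E_P[M_1]\le1$. A $\mathcal P$-$e$-process is a nonnegative adapted process $(W_n)$ such that for each $P\in\mathcal P$ there is a test $P$-supermartingale $(M_n^{(P)})$ with $W_n\le M_n^{(P)}$ for all $n$, $P$-a.s. It has sublinear portfolio regret if there is a deterministic sequence $r_n=o(n)$ with $\max_{\lambda\in\triangle_d}\sum_{i=1}^n\log(\lambda^\top\mathbf E_i)-\log(W_n)\le r_n$ for all $n$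 and every outcome. For an alternative $Q$: $\lambda_Q\in\arg\max_{\lambda\in\triangle_d}\mathbb E_Q[\log(\lambda^\top\mathbf E_1)]$ and $\ell_Q^\star=\mathbb E_Q[\log(\lambda_Q^\top\mathbf E_1)]$, understood to be well defined and finite. Conventions: $\inf\emptyset=\infty$, $\log0=-\infty$. *)

theory Defs
  imports "HOL-Probability.Probability" "HOL-Library.Landau_Symbols"
begin

text \<open>
  Vectors with coordinates \<open>0, \<dots>, d\<close> have the index type \<open>'d option\<close>: \<open>None\<close> is the
  coordinate \<open>0\<close>, \<open>Some j\<close> for \<open>j :: 'd\<close> are the coordinates \<open>1, \<dots>, d\<close>, and \<open>d = CARD('d)\<close>.
\<close>

definition prob_simplex :: "(real ^ ('d::finite option)) set" where
  "prob_simplex = {l. (\<forall>j. 0 \<le> l $ j \<and> l $ j \<le> 1) \<and> (\<Sum>j\<in>UNIV. l $ j) = 1}"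

definition evecs :: "(real ^ ('d::finite option)) set" where
  "evecs = {x. x $ None = 1 \<and> (\<forall>j. 0 \<le> x $ j)}"

text \<open>
  The canonical space of outcomes \<open>\<omega> = (E\<^sub>1, E\<^sub>2, \<dots>)\<close>; the \<open>n\<close>-th random vector is
  \<open>\<lambda>\<omega>. \<omega> n\<close> for \<open>n \<ge> 1\<close>, and index \<open>0\<close> carries no information.
\<close>

definition seq_space :: "(nat \<Rightarrow> real ^ ('d::finite option)) measure" where
  "seq_space = PiM {1..} (\<lambda>_. restrict_space borel evecs)"

definition filt :: "nat \<Rightarrow> (nat \<Rightarrow> real ^ ('d::finite option)) measure" where
  "filt n = sigma (space seq_space)
     {(\<lambda>\<omega>. \<omega> i) -` A \<inter> space seq_space | i A. i \<in> {1..n} \<and> A \<in> sets borel}"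

definition iid_law :: "(nat \<Rightarrow> real ^ ('d::finite option)) measure \<Rightarrow> bool" where
  "iid_law P \<longleftrightarrow> prob_space P \<and> sets P = sets seq_space \<and>
     prob_space.indep_vars P (\<lambda>_. borel) (\<lambda>n \<omega>. \<omega> n) {1..} \<and>
     (\<forall>n\<ge>1. distr P borel (\<lambda>\<omega>. \<omega> n) = distr P borel (\<lambda>\<omega>. \<omega> 1))"

definition null_laws :: "(nat \<Rightarrow> real ^ ('d::finite option)) measure set" where
  "null_laws = {P. iid_law P \<and> (\<forall>j. (\<integral>\<^sup>+\<omega>. ennreal (\<omega> 1 $ Some j) \<partial>P) \<le> 1)}"

definition nonneg_adapted :: "(nat \<Rightarrow> (nat \<Rightarrow> real ^ ('d::finite option)) \<Rightarrow> real) \<Rightarrow> bool" where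
  "nonneg_adapted X \<longleftrightarrow>
     (\<forall>n\<ge>1. X n \<in> borel_measurable (filt n) \<and> (\<forall>\<omega>\<in>space seq_space. 0 \<le> X n \<omega>))"

definition test_supermartingale ::
    "(nat \<Rightarrow> real ^ ('d::finite option)) measure
      \<Rightarrow> (nat \<Rightarrow> (nat \<Rightarrow> real ^ ('d option)) \<Rightarrow> real) \<Rightarrow> bool" where
  "test_supermartingale P M \<longleftrightarrow> nonneg_adapted M \<and>
     (\<forall>n\<ge>2. AE \<omega> in P. nn_cond_exp P (filt (n - 1)) (\<lambda>\<omega>. ennreal (M n \<omega>)) \<omega>
                          \<le> ennreal (M (n - 1) \<omega>)) \<and>
     (\<integral>\<^sup>+\<omega>. ennreal (M 1 \<omega>) \<partial>P) \<le> 1"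

definition e_process :: "(nat \<Rightarrow> (nat \<Rightarrow> real ^ ('d::finite option)) \<Rightarrow> real) \<Rightarrow> bool" where
  "e_process W \<longleftrightarrow> nonneg_adapted W \<and>
     (\<forall>P\<in>null_laws. \<exists>M. test_supermartingale P M \<and> (AE \<omega> in P. \<forall>n\<ge>1. W n \<omega> \<le> M n \<omega>))"

text \<open>Logarithm of a nonnegative number, with \<open>log 0 = -\<infinity>\<close> (whereas \<open>ln 0 = 0\<close>).\<close>

definition elog :: "real \<Rightarrow> ereal" where
  "elog x = (if 0 < x then ereal (ln x) else - \<infinity>)"

text \<open>
  The supremum in the regret is attained, and it is never \<open>\<infinity>\<close>; it is nonnegative, the weight
  vector concentrated on coordinate \<open>0\<close> giving \<open>0\<close>. So no \<open>\<infinity> - \<infinity>\<close> arises,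
  and \<open>W n \<omega> = 0\<close> violates the bound.
\<close>

definition sublinear_portfolio_regret ::
    "(nat \<Rightarrow> (nat \<Rightarrow> real ^ ('d::finite option)) \<Rightarrow> real) \<Rightarrow> bool" where
  "sublinear_portfolio_regret W \<longleftrightarrow>
     (\<exists>r :: nat \<Rightarrow> real. r \<in> o(\<lambda>n. real n) \<and>
       (\<forall>n\<ge>1. \<forall>\<omega>\<in>space seq_space.
          (SUP l\<in>prob_simplex. \<Sum>i=1..n. elog (l \<bullet> \<omega> i)) - elog (W n \<omega>) \<le> ereal (r n)))"

text \<open>
  Extended expectation: positive part minus negative part. If both parts are infinite, the
  value is \<open>\<infinity> - \<infinity> = \<infinity>\<close>; a finite value therefore means that the expectation exists.
\<close>

definition ereal_expectation :: "'a measure \<Rightarrow> ('a \<Rightarrow> ereal) \<Rightarrow> ereal" where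
  "ereal_expectation M f =
     enn2ereal (\<integral>\<^sup>+x. e2ennreal (f x) \<partial>M) - enn2ereal (\<integral>\<^sup>+x. e2ennreal (- f x) \<partial>M)"

definition growth_rate ::
    "(nat \<Rightarrow> real ^ ('d::finite option)) measure \<Rightarrow> real ^ ('d option) \<Rightarrow> ereal" where
  "growth_rate Q l = ereal_expectation Q (\<lambda>\<omega>. elog (l \<bullet> \<omega> 1))"

text \<open>
  A maximiser with finite maximum. When the maximum is finite, no competitor is ill-defined:
  if the positive part of \<open>log (l' \<bullet> E\<^sub>1)\<close> had infinite expectation, the midpoint of \<open>l\<close> and
  \<open>l'\<close> would have growth rate \<open>\<infinity>\<close>.
\<close>

definition log_optimal ::
    "(nat \<Rightarrow> real ^ ('d::finite option)) measure \<Rightarrow> real ^ ('d option) \<Rightarrow> bool" where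
  "log_optimal Q l \<longleftrightarrow> l \<in> prob_simplex \<and> \<bar>growth_rate Q l\<bar> \<noteq> \<infinity> \<and>
     (\<forall>l'\<in>prob_simplex. growth_rate Q l' \<le> growth_rate Q l)"

definition abs_powr :: "ereal \<Rightarrow> real \<Rightarrow> ennreal" where
  "abs_powr x s = (if \<bar>x\<bar> = \<infinity> then \<infinity> else ennreal (\<bar>real_of_ereal x\<bar> powr s))"

definition rejection_time ::
    "(nat \<Rightarrow> (nat \<Rightarrow> real ^ ('d::finite option)) \<Rightarrow> real) \<Rightarrow> real
      \<Rightarrow> (nat \<Rightarrow> real ^ ('d option)) \<Rightarrow> enat" where
  "rejection_time W \<alpha> \<omega> = Inf {enat n | n. 1 \<le> n \<and> 1 / \<alpha> \<le> W n \<omega>}"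

text \<open>
  The library's \<open>stopping_time\<close> has times of the same type as the index of the filtration,
  which here would exclude the value \<open>\<infinity>\<close>.
\<close>

definition extended_stopping_time :: "((nat \<Rightarrow> real ^ ('d::finite option)) \<Rightarrow> enat) \<Rightarrow> bool" where
  "extended_stopping_time \<tau> \<longleftrightarrow> (\<forall>\<omega>\<in>space seq_space. 1 \<le> \<tau> \<omega>) \<and>
     (\<forall>n\<ge>1. {\<omega> \<in> space seq_space. \<tau> \<omega> = enat n} \<in> sets (filt n))"

definition expected_time ::
    "(nat \<Rightarrow> real ^ ('d::finite option)) measure
      \<Rightarrow> ((nat \<Rightarrow> real ^ ('d option)) \<Rightarrow> enat) \<Rightarrow> ennreal" where
  "expected_time Q \<tau> = (\<integral>\<^sup>+\<omega>. ennreal_of_enat (\<tau> \<omega>) \<partial>Q)"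

end

theory Submission
  imports Defs
begin

text \<open>
  Both bounds compare the log-wealth \<open>S\<^sub>n = \<Sum>i\<le>n. log (\<lambda>\<^sub>Q \<bullet> E\<^sub>i)\<close> of the log-optimal portfolio, a random
  walk under \<open>Q\<close> with drift \<open>\<ell>\<^sub>Q\<close>, with the level \<open>log (1 / \<alpha>)\<close>.

  Upper bound. Sublinear regret against all constant portfolios gives \<open>log W\<^sub>n \<ge> S\<^sub>n - r\<^sub>n\<close>,
  and \<open>r\<^sub>n \<le> \<delta> n + K\<close> for every \<open>\<delta> > 0\<close> and a suitable \<open>K\<close>. Hence rejection happens at the latest
  when a random walk of drift about \<open>\<ell>\<^sub>Q - \<delta>\<close> passes \<open>log (1 / \<alpha>) + K\<close>. After truncation
  of the steps from above, Wald's identity shows that this takes about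
  \<open>log (1 / \<alpha>) / \<ell>\<^sub>Q\<close> steps on average (\<open>expected_passage_time_bound\<close>); the moment
  condition makes the loss of drift by truncation small uniformly in \<open>Q\<close>
  (\<open>expected_rejection_time_bound\<close>).

  Lower bound. Optimality of \<open>\<lambda>\<^sub>Q\<close> implies \<open>E\<^sub>Q[E\<^sub>1\<^sup>(\<^sup>j\<^sup>) / (\<lambda>\<^sub>Q \<bullet> E\<^sub>1)] \<le> 1\<close> for every coordinate \<open>j\<close>
  (\<open>numeraire_property\<close>). Therefore tilting \<open>Q\<close> by \<open>1 / (\<lambda>\<^sub>Q \<bullet> E)\<close> at every step yields, after
  restoring the missing mass at \<open>(1, 0, \<dots>, 0)\<close>, a distribution \<open>P\<close> in the null hypothesis
  (\<open>dominating_null_law\<close>) whose likelihood ratio to \<open>Q\<close> at time \<open>n\<close> is at least \<open>exp (- S\<^sub>n)\<close>. A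
  stopping time of level \<open>\<alpha>\<close> and finite mean then satisfies
  \<open>\<alpha> \<ge> P(\<tau> < \<infinity>) \<ge> E\<^sub>Q[exp (- S\<^sub>\<tau>)] \<ge> exp (- E\<^sub>Q[S\<^sub>\<tau>])\<close>, and
  \<open>E\<^sub>Q[S\<^sub>\<tau>] = \<ell>\<^sub>Q E\<^sub>Q[\<tau>]\<close> by Wald's identity.
\<close>

section \<open>Events of the past and independence of the next observation\<close>

lemma space_seq_space: "space seq_space = PiE {1..} (\<lambda>_. evecs)"
  by (simp add: seq_space_def space_PiM space_restrict_space)

lemma coordinate_in_evecs:
  assumes "\<omega> \<in> space seq_space" "n \<ge> 1"
  shows "\<omega> n \<in> evecs"
  using assms by (auto simp: space_seq_space)

lemma measurable_coordinate_seq_space: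
  assumes "n \<ge> 1"
  shows "(\<lambda>\<omega>. \<omega> n) \<in> seq_space \<rightarrow>\<^sub>M borel"
proof -
  have "(\<lambda>\<omega>. \<omega> n) \<in> seq_space \<rightarrow>\<^sub>M restrict_space borel evecs"
    unfolding seq_space_def using assms by (intro measurable_component_singleton) auto
  then show ?thesis
    by (rule measurable_restrict_space2_iff[THEN iffD1, THEN conjunct1])
qed

lemma space_filt: "space (filt n) = space seq_space"
  unfolding filt_def by (intro space_measure_of) auto

lemma measurable_coordinate_filt:
  assumes "i \<in> {1..n}"
  shows "(\<lambda>\<omega>. \<omega> i) \<in> filt n \<rightarrow>\<^sub>M borel"
proof (rule measurableI)
  fix A :: "(real ^ 'a option) set"
  assume "A \<in> sets borel"
  then have "(\<lambda>\<omega>. \<omega> i) -` A \<inter> space seq_space \<in>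
      {(\<lambda>\<omega>. \<omega> i) -` A \<inter> space seq_space | i A. i \<in> {1..n} \<and> A \<in> sets borel}"
    using assms by blast
  then show "(\<lambda>\<omega>. \<omega> i) -` A \<inter> space (filt n) \<in> sets (filt n)"
    unfolding space_filt unfolding filt_def by (subst sets_measure_of) auto
qed auto

text \<open>
  The sets on the right form a \<open>\<sigma>\<close>-algebra containing the generators of \<open>filt n\<close>. Writing a
  past event as a condition on the vector of the first \<open>n\<close> coordinates turns statements about
  \<open>filt n\<close> into statements about finite products.
\<close>

lemma filt_eventD:
  assumes "A \<in> sets (filt n)"
  obtains B where "B \<in> sets (PiM {1..n} (\<lambda>_. borel))"
    and "A = {\<omega> \<in> space seq_space. restrict \<omega> {1..n} \<in> B}"
proof -
  let ?X = "\<lambda>\<omega>::nat \<Rightarrow> real ^ 'a option. restrict \<omega> {1..n}"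
  let ?N = "PiM {1..n} (\<lambda>_. borel) :: (nat \<Rightarrow> real ^ 'a option) measure"
  let ?V = "vimage_algebra (space seq_space) ?X ?N"
  have X: "?X \<in> space seq_space \<rightarrow> space ?N"
    by (auto simp: space_PiM)
  have "{(\<lambda>\<omega>. \<omega> i) -` A \<inter> space seq_space | i A. i \<in> {1..n} \<and> A \<in> sets borel} \<subseteq> sets ?V"
  proof safe
    fix i :: nat and C :: "(real ^ 'a option) set"
    assume i: "i \<in> {1..n}" and C: "C \<in> sets borel"
    have "(\<lambda>x. x i) -` C \<inter> space ?N \<in> sets ?N"
      by (rule measurable_sets[OF measurable_component_singleton[OF i] C])
    moreover have "(\<lambda>\<omega>. \<omega> i) -` C \<inter> space seq_space
        = ?X -` ((\<lambda>x. x i) -` C \<inter> space ?N) \<inter> space seq_space"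
      using i X by auto
    ultimately show "(\<lambda>\<omega>. \<omega> i) -` C \<inter> space seq_space \<in> sets ?V"
      unfolding sets_vimage_algebra2[OF X] by blast
  qed
  then have "sigma_sets (space seq_space)
      {(\<lambda>\<omega>. \<omega> i) -` A \<inter> space seq_space | i A. i \<in> {1..n} \<and> A \<in> sets borel} \<subseteq> sets ?V"
    using sets.sigma_sets_subset[of _ ?V] by simp
  then have "sets (filt n) \<subseteq> sets ?V"
    unfolding filt_def by (subst sets_measure_of) auto
  with assms have "A \<in> sets ?V"
    by auto
  then obtain B where "B \<in> sets ?N" "A = ?X -` B \<inter> space seq_space"
    unfolding sets_vimage_algebra2[OF X] by blast
  then show ?thesis
    by (intro that[of B]) auto
qed

lemma sets_filt_subset:
  "sets (filt n :: (nat \<Rightarrow> real ^ ('d::finite option)) measure) \<subseteq> sets seq_space"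
proof -
  have "{(\<lambda>\<omega>. \<omega> i) -` A \<inter> space seq_space | i A. i \<in> {1..n} \<and> A \<in> sets borel}
      \<subseteq> sets (seq_space :: (nat \<Rightarrow> real ^ 'd option) measure)"
    by (auto intro!: measurable_sets[OF measurable_coordinate_seq_space])
  then have "sigma_sets (space seq_space)
      {(\<lambda>\<omega>. \<omega> i) -` A \<inter> space seq_space | i A. i \<in> {1..n} \<and> A \<in> sets borel}
      \<subseteq> sets (seq_space :: (nat \<Rightarrow> real ^ 'd option) measure)"
    by (rule sets.sigma_sets_subset)
  then show ?thesis
    unfolding filt_def by (subst sets_measure_of) auto
qed

lemma iid_lawD:
  assumes "iid_law Q"
  shows "prob_space Q" "sets Q = sets seq_space" "space Q = space seq_space"
    "prob_space.indep_vars Q (\<lambda>_. borel) (\<lambda>n \<omega>. \<omega> n) {1..}"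
    "\<And>n. n \<ge> 1 \<Longrightarrow> distr Q borel (\<lambda>\<omega>. \<omega> n) = distr Q borel (\<lambda>\<omega>. \<omega> 1)"
    "\<And>n. n \<ge> 1 \<Longrightarrow> (\<lambda>\<omega>. \<omega> n) \<in> Q \<rightarrow>\<^sub>M borel"
proof -
  show "prob_space Q" "sets Q = sets seq_space"
    "prob_space.indep_vars Q (\<lambda>_. borel) (\<lambda>n \<omega>. \<omega> n) {1..}"
    "\<And>n. n \<ge> 1 \<Longrightarrow> distr Q borel (\<lambda>\<omega>. \<omega> n) = distr Q borel (\<lambda>\<omega>. \<omega> 1)"
    using assms unfolding iid_law_def by blast+
  then show "space Q = space seq_space"
    by (intro sets_eq_imp_space_eq)
  show "(\<lambda>\<omega>. \<omega> n) \<in> Q \<rightarrow>\<^sub>M borel" if "n \<ge> 1" for n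
    using measurable_coordinate_seq_space[OF that]
    by (subst measurable_cong_sets[OF \<open>sets Q = sets seq_space\<close> refl])
qed

text \<open>
  An event of the past depends on the coordinates up to \<open>n\<close> only, hence is independent of
  coordinate \<open>n + 1\<close>. Applied to the event that a stopping rule has not stopped by
  time \<open>n\<close>, this is the single probabilistic fact behind both forms of Wald's identity below.
\<close>

lemma iid_next_step:
  fixes y :: "real ^ ('d::finite option) \<Rightarrow> real"
  assumes Q: "iid_law Q" and A: "A \<in> sets (filt n)"
    and y[measurable]: "y \<in> borel_measurable borel" and int: "integrable Q (\<lambda>\<omega>. y (\<omega> 1))"
  shows "integrable Q (\<lambda>\<omega>. indicator A \<omega> * y (\<omega> (Suc n)))"
    and "(\<integral>\<omega>. indicator A \<omega> * y (\<omega> (Suc n)) \<partial>Q) = measure Q A * (\<integral>\<omega>. y (\<omega> 1) \<partial>Q)"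
proof -
  note Q' = iid_lawD[OF Q]
  interpret prob_space Q by (rule Q'(1))
  note [measurable] = Q'(6)
  obtain B where B[measurable]: "B \<in> sets (PiM {1..n} (\<lambda>_. borel))"
    and AB: "A = {\<omega> \<in> space seq_space. restrict \<omega> {1..n} \<in> B}"
    using A by (rule filt_eventD)
  let ?X = "\<lambda>\<omega>. indicator B (restrict \<omega> {1..n}) :: real" and ?Y = "\<lambda>\<omega>. y (\<omega> (Suc n))"
  have "indep_var (PiM {1..n} (\<lambda>_. borel)) (\<lambda>\<omega>. restrict \<omega> {1..n})
      (PiM {Suc n} (\<lambda>_. borel)) (\<lambda>\<omega>. restrict \<omega> {Suc n})"
    using indep_var_restrict[OF Q'(4), of "{1..n}" "{Suc n}"] by auto
  then have "indep_var borel ((indicator B :: _ \<Rightarrow> real) \<circ> (\<lambda>\<omega>. restrict \<omega> {1..n}))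
      borel ((\<lambda>x. y (x (Suc n))) \<circ> (\<lambda>\<omega>. restrict \<omega> {Suc n}))"
    by (rule indep_var_compose) measurable
  then have ind: "indep_var borel ?X borel ?Y"
    by (simp add: comp_def)
  have dist: "distr Q borel (\<lambda>\<omega>. \<omega> (Suc n)) = distr Q borel (\<lambda>\<omega>. \<omega> 1)"
    using Q'(5)[of "Suc n"] by simp
  have Y: "integrable Q ?Y"
    using int integrable_distr_eq[of "\<lambda>\<omega>. \<omega> (Suc n)" Q borel y]
      integrable_distr_eq[of "\<lambda>\<omega>. \<omega> 1" Q borel y] by (simp add: dist Q'(6))
  have EY: "(\<integral>\<omega>. ?Y \<omega> \<partial>Q) = (\<integral>\<omega>. y (\<omega> 1) \<partial>Q)"
    using integral_distr[of "\<lambda>\<omega>. \<omega> (Suc n)" Q borel y]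
      integral_distr[of "\<lambda>\<omega>. \<omega> 1" Q borel y] by (simp add: dist Q'(6))
  have XA: "?X \<omega> = indicator A \<omega>" if "\<omega> \<in> space Q" for \<omega>
    using that by (auto simp: AB indicator_def Q'(3))
  have A': "A \<in> sets Q"
    using A sets_filt_subset Q'(2) by auto
  have IA: "integrable Q (indicator A :: _ \<Rightarrow> real)"
    using A' by (simp add: integrable_indicator_iff emeasure_finite less_top[symmetric])
  have X: "integrable Q ?X"
    using IA by (subst Bochner_Integration.integrable_cong[OF refl XA])
  have "(\<integral>\<omega>. ?X \<omega> \<partial>Q) = (\<integral>\<omega>. indicator A \<omega> \<partial>Q)"
    by (rule Bochner_Integration.integral_cong[OF refl XA])
  then have EX: "(\<integral>\<omega>. ?X \<omega> \<partial>Q) = measure Q A"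
    using sets.Int_space_eq2[OF A'] by simp
  show "integrable Q (\<lambda>\<omega>. indicator A \<omega> * y (\<omega> (Suc n)))"
    using indep_var_integrable[OF ind X Y]
    by (rule Bochner_Integration.integrable_cong[THEN iffD1, rotated -1]) (use XA in auto)
  have "(\<integral>\<omega>. indicator A \<omega> * y (\<omega> (Suc n)) \<partial>Q) = (\<integral>\<omega>. ?X \<omega> * ?Y \<omega> \<partial>Q)"
    by (intro Bochner_Integration.integral_cong) (use XA in auto)
  also have "\<dots> = measure Q A * (\<integral>\<omega>. y (\<omega> 1) \<partial>Q)"
    using indep_var_lebesgue_integral[OF ind X Y] EX EY by simp
  finally show "(\<integral>\<omega>. indicator A \<omega> * y (\<omega> (Suc n)) \<partial>Q) = measure Q A * (\<integral>\<omega>. y (\<omega> 1) \<partial>Q)" .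
qed

lemma ennreal_of_enat_eq_suminf:
  "ennreal_of_enat t = (\<Sum>k. if enat k < t then 1 else 0)"
proof (cases t)
  case (enat n)
  have "(\<Sum>k. if enat k < t then 1 else 0 :: ennreal) = (\<Sum>k<n. if enat k < t then 1 else 0)"
    by (rule suminf_finite) (auto simp: enat)
  also have "\<dots> = of_nat n"
    by (simp add: enat)
  finally show ?thesis
    by (simp add: enat)
next
  case infinity
  have "(\<Sum>k. 1 :: ennreal) = \<infinity>"
  proof (rule ccontr)
    assume "(\<Sum>k. 1 :: ennreal) \<noteq> \<infinity>"
    then obtain n :: nat where n: "(\<Sum>k. 1 :: ennreal) < of_nat n"
      using ennreal_Ex_less_of_nat by (auto simp: less_top)
    have "(\<Sum>k<n. 1 :: ennreal) \<le> (\<Sum>k. 1)"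
      by (rule sum_le_suminf) auto
    with n show False
      by simp
  qed
  then show ?thesis
    by (simp add: infinity)
qed

lemma expected_time_eq_suminf:
  assumes "iid_law Q"
    and "\<And>k. {\<omega> \<in> space seq_space. enat k < \<tau> \<omega>} \<in> sets seq_space"
  shows "expected_time Q \<tau> = (\<Sum>k. emeasure Q {\<omega> \<in> space seq_space. enat k < \<tau> \<omega>})"
proof -
  note Q' = iid_lawD[OF assms(1)]
  have "expected_time Q \<tau> = (\<integral>\<^sup>+\<omega>. (\<Sum>k. indicator {\<omega> \<in> space seq_space. enat k < \<tau> \<omega>} \<omega>) \<partial>Q)"
    unfolding expected_time_def ennreal_of_enat_eq_suminf
    by (intro nn_integral_cong suminf_cong) (auto simp: Q'(3) indicator_def)
  also have "\<dots> = (\<Sum>k. emeasure Q {\<omega> \<in> space seq_space. enat k < \<tau> \<omega>})"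
    using assms(2) by (subst nn_integral_suminf) (auto intro!: borel_measurable_indicator simp: Q'(2))
  finally show ?thesis .
qed

section \<open>Domination of one i.i.d. law by another on the past\<close>

lemma iid_finite_joint_law:
  assumes "iid_law Q" "n \<ge> 1"
  shows "distr Q (PiM {1..n} (\<lambda>_. borel)) (\<lambda>\<omega>. restrict \<omega> {1..n})
    = PiM {1..n} (\<lambda>_. distr Q borel (\<lambda>\<omega>. \<omega> 1))"
proof -
  note Q' = iid_lawD[OF assms(1)]
  interpret prob_space Q by (rule Q'(1))
  have "indep_vars (\<lambda>_. borel) (\<lambda>n \<omega>. \<omega> n) {1..n}"
    by (rule indep_vars_subset[OF Q'(4)]) auto
  then have "distr Q (PiM {1..n} (\<lambda>_. borel)) (\<lambda>\<omega>. \<lambda>i\<in>{1..n}. \<omega> i)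
      = PiM {1..n} (\<lambda>i. distr Q borel (\<lambda>\<omega>. \<omega> i))"
    using assms(2) Q'(6) by (subst (asm) indep_vars_iff_distr_eq_PiM') auto
  also have "\<dots> = PiM {1..n} (\<lambda>_. distr Q borel (\<lambda>\<omega>. \<omega> 1))"
    by (intro PiM_cong refl Q'(5)) auto
  finally show ?thesis .
qed

text \<open>
  Integrating out one coordinate at a time, each step replaces one factor \<open>h \<partial>\<nu>\<close> by the larger
  \<open>\<mu>\<close>.
\<close>

lemma product_domination:
  fixes h :: "'a \<Rightarrow> ennreal"
  assumes \<nu>: "prob_space \<nu>" and \<mu>: "prob_space \<mu>" and sets_eq: "sets \<mu> = sets \<nu>"
    and h: "h \<in> borel_measurable \<nu>"
    and dom: "\<And>g. g \<in> borel_measurable \<nu> \<Longrightarrow> (\<integral>\<^sup>+x. g x * h x \<partial>\<nu>) \<le> (\<integral>\<^sup>+x. g x \<partial>\<mu>)"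
    and I: "finite I" and f: "f \<in> borel_measurable (PiM I (\<lambda>_. \<nu>))"
  shows "(\<integral>\<^sup>+x. f x * (\<Prod>i\<in>I. h (x i)) \<partial>PiM I (\<lambda>_. \<nu>)) \<le> (\<integral>\<^sup>+x. f x \<partial>PiM I (\<lambda>_. \<mu>))"
  using I f
proof (induction I arbitrary: f)
  case empty
  then show ?case
    by (simp add: PiM_empty)
next
  case (insert i I)
  interpret \<nu>: product_sigma_finite "\<lambda>_. \<nu>"
    by (intro product_sigma_finite.intro prob_space_imp_sigma_finite \<nu>)
  interpret \<mu>: product_sigma_finite "\<lambda>_. \<mu>"
    by (intro product_sigma_finite.intro prob_space_imp_sigma_finite \<mu>)
  interpret \<nu>1: prob_space \<nu> by (rule \<nu>)
  interpret \<mu>1: prob_space \<mu> by (rule \<mu>)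
  note [measurable] = h insert.prems
  note [measurable_cong] = sets_eq
  have PiM_eq: "sets (PiM J (\<lambda>_. \<mu>)) = sets (PiM J (\<lambda>_. \<nu>))" for J :: "'b set"
    by (intro sets_PiM_cong refl sets_eq)
  have f\<mu>: "f \<in> borel_measurable (PiM (insert i I) (\<lambda>_. \<mu>))"
    using insert.prems by (simp add: measurable_cong_sets[OF PiM_eq refl])
  have upd[measurable]: "(\<lambda>(x, y). f (x(i := y))) \<in> borel_measurable (PiM I (\<lambda>_. \<nu>) \<Otimes>\<^sub>M \<nu>)"
    using measurable_comp[OF measurable_add_dim insert.prems] by (simp add: comp_def case_prod_beta')
  have upd1: "(\<lambda>y. f (x(i := y))) \<in> borel_measurable \<nu>" if "x \<in> space (PiM I (\<lambda>_. \<nu>))" for x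
    using measurable_compose[OF measurable_Pair1'[OF that] upd] by simp
  have upd\<mu>: "(\<lambda>(x, y). f (x(i := y))) \<in> borel_measurable (PiM I (\<lambda>_. \<nu>) \<Otimes>\<^sub>M \<mu>)"
    using upd by (simp add: measurable_cong_sets[OF sets_pair_measure_cong[OF refl sets_eq] refl])
  have "(\<integral>\<^sup>+x. f x * (\<Prod>j\<in>insert i I. h (x j)) \<partial>PiM (insert i I) (\<lambda>_. \<nu>))
      = (\<integral>\<^sup>+x. (\<integral>\<^sup>+y. f (x(i := y)) * (\<Prod>j\<in>insert i I. h ((x(i := y)) j)) \<partial>\<nu>) \<partial>PiM I (\<lambda>_. \<nu>))"
    using insert.hyps by (intro \<nu>.product_nn_integral_insert) measurable
  also have "\<dots> = (\<integral>\<^sup>+x. (\<integral>\<^sup>+y. (f (x(i := y)) * h y) * (\<Prod>j\<in>I. h (x j)) \<partial>\<nu>) \<partial>PiM I (\<lambda>_. \<nu>))"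
  proof (intro nn_integral_cong)
    fix x y
    have "(\<Prod>j\<in>I. h ((x(i := y)) j)) = (\<Prod>j\<in>I. h (x j))"
      using insert.hyps by (intro prod.cong) auto
    then show "f (x(i := y)) * (\<Prod>j\<in>insert i I. h ((x(i := y)) j))
        = (f (x(i := y)) * h y) * (\<Prod>j\<in>I. h (x j))"
      using insert.hyps by (simp add: mult.assoc)
  qed
  also have "\<dots> = (\<integral>\<^sup>+x. (\<integral>\<^sup>+y. f (x(i := y)) * h y \<partial>\<nu>) * (\<Prod>j\<in>I. h (x j)) \<partial>PiM I (\<lambda>_. \<nu>))"
    using upd1 h by (intro nn_integral_cong nn_integral_multc) auto
  also have "\<dots> \<le> (\<integral>\<^sup>+x. (\<integral>\<^sup>+y. f (x(i := y)) \<partial>\<mu>) * (\<Prod>j\<in>I. h (x j)) \<partial>PiM I (\<lambda>_. \<nu>))"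
    using upd1 by (intro nn_integral_mono mult_right_mono dom) auto
  also have "\<dots> \<le> (\<integral>\<^sup>+x. (\<integral>\<^sup>+y. f (x(i := y)) \<partial>\<mu>) \<partial>PiM I (\<lambda>_. \<mu>))"
    by (intro insert.IH upd\<mu> sigma_finite_measure.borel_measurable_nn_integral[OF prob_space_imp_sigma_finite[OF \<mu>]])
  also have "\<dots> = (\<integral>\<^sup>+x. f x \<partial>PiM (insert i I) (\<lambda>_. \<mu>))"
    using insert.hyps f\<mu> by (intro \<mu>.product_nn_integral_insert[symmetric])
  finally show ?case .
qed

text \<open>
  If the one-step law of \<open>P\<close> dominates \<open>h\<close> times that of \<open>Q\<close>, then on events of
  \<open>filt n\<close> the product of the \<open>h\<close> acts as a lower bound for the likelihood ratio of \<open>P\<close> to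
  \<open>Q\<close>. Only an inequality is asked for, so that \<open>P\<close> may carry mass that \<open>Q\<close> does not see.
\<close>

lemma iid_law_past_domination:
  fixes h :: "real ^ ('d::finite option) \<Rightarrow> ennreal"
  assumes Q: "iid_law Q" and P: "iid_law P" and h[measurable]: "h \<in> borel_measurable borel"
    and dom: "\<And>g. g \<in> borel_measurable borel \<Longrightarrow>
      (\<integral>\<^sup>+\<omega>. g (\<omega> 1) * h (\<omega> 1) \<partial>Q) \<le> (\<integral>\<^sup>+\<omega>. g (\<omega> 1) \<partial>P)"
    and n: "n \<ge> 1" and A: "A \<in> sets (filt n)"
  shows "(\<integral>\<^sup>+\<omega>. indicator A \<omega> * (\<Prod>i\<in>{1..n}. h (\<omega> i)) \<partial>Q) \<le> emeasure P A"
proof -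
  note Q' = iid_lawD[OF Q] and P' = iid_lawD[OF P]
  let ?\<nu> = "distr Q borel (\<lambda>\<omega>. \<omega> 1)" and ?\<mu> = "distr P borel (\<lambda>\<omega>. \<omega> 1)"
  let ?N = "PiM {1..n} (\<lambda>_. borel) :: (nat \<Rightarrow> real ^ 'd option) measure"
  obtain B where B[measurable]: "B \<in> sets ?N"
    and AB: "A = {\<omega> \<in> space seq_space. restrict \<omega> {1..n} \<in> B}"
    using A by (rule filt_eventD)
  have rQ: "(\<lambda>\<omega>. restrict \<omega> {1..n}) \<in> Q \<rightarrow>\<^sub>M ?N"
    using Q'(6) by (intro measurable_restrict) auto
  have rP: "(\<lambda>\<omega>. restrict \<omega> {1..n}) \<in> P \<rightarrow>\<^sub>M ?N"
    using P'(6) by (intro measurable_restrict) auto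
  have ind: "(indicator A \<omega> :: ennreal) = indicator B (restrict \<omega> {1..n})" if "\<omega> \<in> space seq_space" for \<omega>
    using that by (auto simp: AB indicator_def)
  have mN: "(\<lambda>x. indicator B x * (\<Prod>i\<in>{1..n}. h (x i))) \<in> borel_measurable ?N"
    by measurable
  have "(\<integral>\<^sup>+\<omega>. indicator A \<omega> * (\<Prod>i\<in>{1..n}. h (\<omega> i)) \<partial>Q)
      = (\<integral>\<^sup>+\<omega>. indicator B (restrict \<omega> {1..n}) * (\<Prod>i\<in>{1..n}. h (restrict \<omega> {1..n} i)) \<partial>Q)"
    by (intro nn_integral_cong) (simp add: ind Q'(3))
  also have "\<dots> = (\<integral>\<^sup>+x. indicator B x * (\<Prod>i\<in>{1..n}. h (x i))
      \<partial>distr Q ?N (\<lambda>\<omega>. restrict \<omega> {1..n}))"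
    by (rule nn_integral_distr[OF rQ, symmetric]) (use mN in simp)
  also have "\<dots> = (\<integral>\<^sup>+x. indicator B x * (\<Prod>i\<in>{1..n}. h (x i)) \<partial>PiM {1..n} (\<lambda>_. ?\<nu>))"
    by (simp only: iid_finite_joint_law[OF Q n])
  also have "\<dots> \<le> (\<integral>\<^sup>+x. indicator B x \<partial>PiM {1..n} (\<lambda>_. ?\<mu>))"
  proof (rule product_domination)
    show "prob_space ?\<nu>" "prob_space ?\<mu>"
      by (auto intro!: prob_space.prob_space_distr Q' P')
    have "sets (PiM {1..n} (\<lambda>_. ?\<nu>)) = sets ?N"
      by (intro sets_PiM_cong) auto
    then show "(indicator B :: _ \<Rightarrow> ennreal) \<in> borel_measurable (PiM {1..n} (\<lambda>_. ?\<nu>))"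
      using B by (intro borel_measurable_indicator) blast
    show "(\<integral>\<^sup>+x. g x * h x \<partial>?\<nu>) \<le> (\<integral>\<^sup>+x. g x \<partial>?\<mu>)" if "g \<in> borel_measurable ?\<nu>" for g
    proof -
      have g[measurable]: "g \<in> borel_measurable borel"
        using that by simp
      show ?thesis
        using dom[OF g] by (subst (1 2) nn_integral_distr) (use P'(6) Q'(6) in auto)
    qed
  qed auto
  also have "\<dots> = (\<integral>\<^sup>+x. indicator B x \<partial>distr P ?N (\<lambda>\<omega>. restrict \<omega> {1..n}))"
    by (simp only: iid_finite_joint_law[OF P n])
  also have "\<dots> = (\<integral>\<^sup>+\<omega>. indicator B (restrict \<omega> {1..n}) \<partial>P)"
    using B by (intro nn_integral_distr[OF rP] borel_measurable_indicator) (simp only: sets_distr)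
  also have "\<dots> = (\<integral>\<^sup>+\<omega>. indicator A \<omega> \<partial>P)"
    by (intro nn_integral_cong) (simp add: ind P'(3))
  also have "\<dots> = emeasure P A"
    using A sets_filt_subset P'(2) by (intro nn_integral_indicator) auto
  finally show ?thesis .
qed

lemma closed_evecs: "closed (evecs :: (real ^ ('d::finite option)) set)"
proof -
  have "evecs = {x :: real ^ 'd option. x $ None = 1} \<inter> (\<Inter>j. {x. 0 \<le> x $ j})"
    by (auto simp: evecs_def)
  also have "closed \<dots>"
    by (intro closed_Int closed_INT ballI closed_Collect_eq closed_Collect_le continuous_intros)
  finally show ?thesis .
qed

text \<open>
  The law is the infinite product of \<open>\<mu>\<close> restricted to \<^const>\<open>evecs\<close>.
\<close>

lemma iid_law_exists:
  fixes \<mu> :: "(real ^ ('d::finite option)) measure"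
  assumes \<mu>: "prob_space \<mu>" "sets \<mu> = sets borel" and supp: "AE x in \<mu>. x \<in> evecs"
  obtains P where "iid_law P" "distr P borel (\<lambda>\<omega>. \<omega> 1) = \<mu>"
proof -
  define \<rho> where "\<rho> = restrict_space \<mu> evecs"
  have ev: "evecs \<in> sets \<mu>" "space \<mu> = UNIV"
    using borel_closed[OF closed_evecs] \<mu>(2) sets_eq_imp_space_eq[OF \<mu>(2)] by auto
  have "emeasure \<mu> evecs = 1"
    using supp ev by (subst prob_space.emeasure_eq_1_AE[OF \<mu>(1)]) auto
  then have \<rho>: "prob_space \<rho>"
    unfolding \<rho>_def using ev by (intro prob_space_restrict_space) auto
  have sets_\<rho>: "sets \<rho> = sets (restrict_space borel evecs)"
    unfolding \<rho>_def by (rule sets_restrict_space_cong[OF \<mu>(2)])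
  have \<rho>_borel: "(\<lambda>x. x) \<in> \<rho> \<rightarrow>\<^sub>M borel"
    unfolding \<rho>_def using \<mu>(2)
    by (intro measurable_restrict_space1) (simp add: measurable_ident_sets)
  have distr_\<rho>: "distr \<rho> borel (\<lambda>x. x) = \<mu>"
  proof (rule measure_eqI)
    fix A assume "A \<in> sets (distr \<rho> borel (\<lambda>x. x))"
    then have A: "A \<in> sets borel"
      by simp
    have "emeasure (distr \<rho> borel (\<lambda>x. x)) A = emeasure \<rho> (A \<inter> evecs)"
      using A \<rho>_borel by (subst emeasure_distr) (auto simp: \<rho>_def space_restrict_space ev)
    also have "\<dots> = emeasure \<mu> (A \<inter> evecs)"
      unfolding \<rho>_def using ev by (intro emeasure_restrict_space) auto
    also have "\<dots> = emeasure \<mu> A"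
      using A \<mu>(2) ev supp by (intro emeasure_eq_AE) auto
    finally show "emeasure (distr \<rho> borel (\<lambda>x. x)) A = emeasure \<mu> A" .
  qed (simp add: \<mu>)
  define P where "P = PiM {1::nat..} (\<lambda>_. \<rho>)"
  interpret P: product_prob_space "\<lambda>_. \<rho>" "{1::nat..}"
    by (intro product_prob_spaceI \<rho>)
  have prob: "prob_space P"
    unfolding P_def by (rule P.prob_space_axioms)
  interpret prob_space P by (rule prob)
  have sets_P: "sets P = sets seq_space"
    unfolding P_def seq_space_def by (intro sets_PiM_cong refl sets_\<rho>)
  have comp: "distr P \<rho> (\<lambda>\<omega>. \<omega> n) = \<rho>" if "n \<ge> 1" for n
    unfolding P_def using that \<rho> by (intro distr_PiM_component) auto
  have meas: "(\<lambda>\<omega>. \<omega> n) \<in> P \<rightarrow>\<^sub>M \<rho>" if "n \<ge> 1" for n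
    unfolding P_def using that by (intro measurable_component_singleton) auto
  have law: "distr P borel (\<lambda>\<omega>. \<omega> n) = \<mu>" if "n \<ge> 1" for n
    using distr_distr[OF \<rho>_borel meas[OF that]] comp[OF that] distr_\<rho> by (simp add: comp_def)
  have "distr P (PiM {1..} (\<lambda>_. \<rho>)) (\<lambda>x. \<lambda>i\<in>{1..}. x i) = distr P P (\<lambda>x. x)"
    by (intro distr_cong) (auto simp: P_def space_PiM PiE_restrict)
  also have "\<dots> = PiM {1..} (\<lambda>_. \<rho>)"
    by (simp add: P_def distr_id)
  also have "\<dots> = PiM {1..} (\<lambda>n. distr P \<rho> (\<lambda>\<omega>. \<omega> n))"
    by (intro PiM_cong refl comp[symmetric]) auto
  finally have "indep_vars (\<lambda>_. \<rho>) (\<lambda>n \<omega>. \<omega> n) {1..}"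
    using meas by (subst indep_vars_iff_distr_eq_PiM') auto
  then have "indep_vars (\<lambda>_. borel) (\<lambda>n \<omega>. \<omega> n) {1..}"
    using \<rho>_borel by (rule indep_vars_compose2)
  with prob sets_P law have "iid_law P"
    unfolding iid_law_def by auto
  with law show ?thesis
    by (intro that) auto
qed

section \<open>The log-optimal portfolio\<close>

lemma e2ennreal_elog: "e2ennreal (elog x) = (if 0 < x then ennreal (ln x) else 0)"
  by (simp add: elog_def e2ennreal_neg)

lemma e2ennreal_uminus_elog: "e2ennreal (- elog x) = (if 0 < x then ennreal (- ln x) else \<infinity>)"
  by (simp add: elog_def)

text \<open>
  With the convention \<open>log 0 = -\<infinity>\<close>, finiteness of the extended expectation forces \<open>f > 0\<close> almost
  surely; from then on the real logarithm and the Bochner integral can be used.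
\<close>

lemma ereal_expectation_elog_finite:
  assumes f[measurable]: "f \<in> borel_measurable M"
    and fin: "\<bar>ereal_expectation M (\<lambda>x. elog (f x))\<bar> \<noteq> \<infinity>"
  shows "AE x in M. 0 < f x" "integrable M (\<lambda>x. ln (f x))"
    "ereal_expectation M (\<lambda>x. elog (f x)) = ereal (\<integral>x. ln (f x) \<partial>M)"
proof -
  define p where "p = (\<integral>\<^sup>+x. e2ennreal (elog (f x)) \<partial>M)"
  define q where "q = (\<integral>\<^sup>+x. e2ennreal (- elog (f x)) \<partial>M)"
  have ex: "ereal_expectation M (\<lambda>x. elog (f x)) = enn2ereal p - enn2ereal q"
    by (simp add: ereal_expectation_def p_def q_def)
  have pq: "p \<noteq> \<infinity>" "q \<noteq> \<infinity>"
    using fin unfolding ex by (cases p; cases q; simp)+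
  have "AE x in M. e2ennreal (- elog (f x)) \<noteq> \<infinity>"
  proof (rule nn_integral_PInf_AE)
    show "(\<lambda>x. e2ennreal (- elog (f x))) \<in> borel_measurable M"
      unfolding e2ennreal_uminus_elog by measurable
    show "(\<integral>\<^sup>+x. e2ennreal (- elog (f x)) \<partial>M) \<noteq> \<infinity>"
      using pq(2) by (simp add: q_def)
  qed
  then show pos: "AE x in M. 0 < f x"
    by eventually_elim (simp add: e2ennreal_uminus_elog split: if_splits)
  have p: "p = (\<integral>\<^sup>+x. ennreal (ln (f x)) \<partial>M)"
    unfolding p_def by (intro nn_integral_cong_AE) (use pos in eventually_elim, simp add: e2ennreal_elog)
  have q: "q = (\<integral>\<^sup>+x. ennreal (- ln (f x)) \<partial>M)"
    unfolding q_def by (intro nn_integral_cong_AE) (use pos in eventually_elim, simp add: e2ennreal_uminus_elog)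
  show int: "integrable M (\<lambda>x. ln (f x))"
    using pq by (simp add: real_integrable_def p q)
  show "ereal_expectation M (\<lambda>x. elog (f x)) = ereal (\<integral>x. ln (f x) \<partial>M)"
    unfolding ex real_lebesgue_integral_def[OF int] p[symmetric] q[symmetric]
    using pq by (cases p; cases q) auto
qed

text \<open>
  For a competitor of the optimal portfolio neither part of the expectation is known to be finite
  beforehand: the integrable minorant \<open>g\<close> controls the negative part, and the upper bound
  then controls the positive part.
\<close>

lemma integrable_ln_of_ereal_expectation_le:
  assumes f[measurable]: "f \<in> borel_measurable M" and pos: "AE x in M. 0 < f x"
    and g: "integrable M g" "AE x in M. g x \<le> ln (f x)"
    and le: "ereal_expectation M (\<lambda>x. elog (f x)) \<le> ereal c"
  shows "integrable M (\<lambda>x. ln (f x))" "(\<integral>x. ln (f x) \<partial>M) \<le> c"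
proof -
  have "(\<integral>\<^sup>+x. ennreal (- ln (f x)) \<partial>M) \<le> (\<integral>\<^sup>+x. ennreal (- g x) \<partial>M)"
    by (intro nn_integral_mono_AE) (use g(2) in eventually_elim, simp add: ennreal_leI)
  also have "\<dots> < \<infinity>"
    using g(1) by (simp add: real_integrable_def less_top)
  finally have q: "(\<integral>\<^sup>+x. ennreal (- ln (f x)) \<partial>M) \<noteq> \<infinity>"
    by simp
  have ex: "ereal_expectation M (\<lambda>x. elog (f x))
      = enn2ereal (\<integral>\<^sup>+x. ennreal (ln (f x)) \<partial>M) - enn2ereal (\<integral>\<^sup>+x. ennreal (- ln (f x)) \<partial>M)"
    unfolding ereal_expectation_def
    by (intro arg_cong2[where f="(-)"] arg_cong[where f=enn2ereal] nn_integral_cong_AE; use pos in eventually_elim)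
      (simp_all add: e2ennreal_elog e2ennreal_uminus_elog)
  then have "\<bar>ereal_expectation M (\<lambda>x. elog (f x))\<bar> \<noteq> \<infinity>"
    using q le by (cases "\<integral>\<^sup>+x. ennreal (ln (f x)) \<partial>M"; cases "\<integral>\<^sup>+x. ennreal (- ln (f x)) \<partial>M") auto
  note fin = ereal_expectation_elog_finite[OF f this]
  show "integrable M (\<lambda>x. ln (f x))" "(\<integral>x. ln (f x) \<partial>M) \<le> c"
    using fin le by auto
qed

lemma log_optimalD:
  assumes "iid_law Q" "log_optimal Q l"
  shows "AE \<omega> in Q. 0 < l \<bullet> \<omega> 1" "integrable Q (\<lambda>\<omega>. ln (l \<bullet> \<omega> 1))"
    "growth_rate Q l = ereal (\<integral>\<omega>. ln (l \<bullet> \<omega> 1) \<partial>Q)"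
proof -
  have m: "(\<lambda>\<omega>. l \<bullet> \<omega> 1) \<in> borel_measurable Q"
    using iid_lawD(6)[OF assms(1), of 1] by simp
  have "\<bar>ereal_expectation Q (\<lambda>\<omega>. elog (l \<bullet> \<omega> 1))\<bar> \<noteq> \<infinity>"
    using assms(2) by (simp add: log_optimal_def growth_rate_def)
  note * = ereal_expectation_elog_finite[OF m this]
  show "AE \<omega> in Q. 0 < l \<bullet> \<omega> 1" "integrable Q (\<lambda>\<omega>. ln (l \<bullet> \<omega> 1))"
    "growth_rate Q l = ereal (\<integral>\<omega>. ln (l \<bullet> \<omega> 1) \<partial>Q)"
    using * by (simp_all add: growth_rate_def)
qed

lemma simplex_mix_axis:
  fixes l :: "real ^ ('d::finite option)"
  assumes "l \<in> prob_simplex" "m \<ge> 0"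
  shows "(m / (m + 1)) *\<^sub>R l + (1 / (m + 1)) *\<^sub>R axis j 1 \<in> prob_simplex"
proof -
  let ?v = "(m / (m + 1)) *\<^sub>R l + (1 / (m + 1)) *\<^sub>R axis j 1"
  have l: "\<And>i. 0 \<le> l $ i" "(\<Sum>i\<in>UNIV. l $ i) = 1"
    using assms by (auto simp: prob_simplex_def)
  have nonneg: "0 \<le> ?v $ i" for i
    using l(1)[of i] assms(2) by (auto simp: axis_def)
  have "(\<Sum>i\<in>UNIV. ?v $ i) = m / (m + 1) * (\<Sum>i\<in>UNIV. l $ i) + 1 / (m + 1) * (\<Sum>i\<in>UNIV. axis j 1 $ i)"
    by (simp add: sum.distrib sum_distrib_left sum_divide_distrib)
  also have "(\<Sum>i\<in>UNIV. axis j (1::real) $ i) = 1"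
    by (simp add: axis_def)
  finally have sum: "(\<Sum>i\<in>UNIV. ?v $ i) = 1"
    using assms(2) by (simp add: l(2) add_divide_distrib[symmetric])
  have "?v $ i \<le> 1" for i
    using member_le_sum[of i UNIV "\<lambda>i. ?v $ i"] nonneg sum by auto
  with nonneg sum show ?thesis
    unfolding prob_simplex_def by blast
qed

text \<open>
  The first-order optimality condition for \<open>l\<close> in the direction of the vertex \<open>j\<close>. Put
  \<open>X = l \<bullet> E\<close> and \<open>R = E\<^sup>(\<^sup>j\<^sup>) / X\<close>, and perturb \<open>l\<close> to
  \<open>(m l + e\<^sub>j) / (m + 1)\<close>; the payoff is multiplied by \<open>(m + R) / (m + 1)\<close>, and by optimality the
  expected logarithm of this factor is at most \<open>0\<close>. Since \<open>ln x \<ge> 1 - 1 / x\<close>, it follows that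
  \<open>E[(R - 1) / (m + R)] \<le> 0\<close>, that is, \<open>E[m R / (m + R)] \<le> E[m / (m + R)] \<le> 1\<close>. The integrand on
  the left tends to \<open>R\<close> as \<open>m \<rightarrow> \<infinity>\<close>, and Fatou's lemma gives \<open>E[R] \<le> 1\<close>.
\<close>

lemma numeraire_property:
  fixes l :: "real ^ ('d::finite option)"
  assumes Q: "iid_law Q" and opt: "log_optimal Q l"
  shows "(\<integral>\<^sup>+\<omega>. ennreal (\<omega> 1 $ j / (l \<bullet> \<omega> 1)) \<partial>Q) \<le> 1"
proof -
  note Q' = iid_lawD[OF Q] and opt' = log_optimalD[OF Q opt]
  interpret prob_space Q by (rule Q'(1))
  have E[measurable]: "(\<lambda>\<omega>. \<omega> 1) \<in> Q \<rightarrow>\<^sub>M borel"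
    by (rule Q'(6)) simp
  define R where "R \<omega> = \<omega> 1 $ j / (l \<bullet> \<omega> 1)" for \<omega> :: "nat \<Rightarrow> real ^ 'd option"
  have [measurable]: "(\<lambda>\<omega>. \<omega> 1 $ j) \<in> borel_measurable Q"
    using measurable_compose[OF E borel_measurable_nth[of j]] by simp
  have R[measurable]: "R \<in> borel_measurable Q"
    unfolding R_def by measurable
  have nonneg: "AE \<omega> in Q. 0 \<le> R \<omega>"
  proof (use opt'(1) AE_space in eventually_elim)
    case (elim \<omega>)
    then have "\<omega> 1 \<in> evecs"
      by (intro coordinate_in_evecs) (auto simp: Q'(3))
    with elim show ?case
      by (simp add: R_def evecs_def)
  qed
  have step: "(\<integral>\<^sup>+\<omega>. ennreal (real (Suc n) * R \<omega> / (real (Suc n) + R \<omega>)) \<partial>Q) \<le> 1" for n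
  proof -
    define m where "m = real (Suc n)"
    have m: "m > 0" "m \<ge> 1"
      by (auto simp: m_def)
    let ?v = "(m / (m + 1)) *\<^sub>R l + (1 / (m + 1)) *\<^sub>R axis j 1"
    have v: "?v \<bullet> \<omega> 1 = (l \<bullet> \<omega> 1) * ((m + R \<omega>) / (m + 1))" if "0 < l \<bullet> \<omega> 1" for \<omega>
    proof -
      have "?v \<bullet> \<omega> 1 = m / (m + 1) * (l \<bullet> \<omega> 1) + 1 / (m + 1) * (\<omega> 1 $ j)"
        by (simp add: inner_add_left inner_axis')
      also have "\<dots> = (l \<bullet> \<omega> 1) * ((m + R \<omega>) / (m + 1))"
      proof -
        have "\<omega> 1 $ j = (l \<bullet> \<omega> 1) * R \<omega>"
          using that by (simp add: R_def)
        then show ?thesis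
          by (simp only:) (simp add: add_divide_distrib algebra_simps)
      qed
      finally show ?thesis .
    qed
    have pos: "AE \<omega> in Q. 0 < ?v \<bullet> \<omega> 1"
      using opt'(1) nonneg
    proof eventually_elim
      case (elim \<omega>)
      then show ?case
        unfolding v[of \<omega>, OF elim(1)] using m by (intro mult_pos_pos divide_pos_pos) auto
    qed
    have lnv: "AE \<omega> in Q. ln (?v \<bullet> \<omega> 1) = ln (l \<bullet> \<omega> 1) + ln ((m + R \<omega>) / (m + 1))"
      using opt'(1) nonneg
    proof eventually_elim
      case (elim \<omega>)
      then show ?case
        unfolding v[of \<omega>, OF elim(1)] using m by (subst ln_mult_pos) auto
    qed
    have "growth_rate Q ?v \<le> growth_rate Q l"
      using opt simplex_mix_axis[of l m j] m by (auto simp: log_optimal_def)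
    then have le: "ereal_expectation Q (\<lambda>\<omega>. elog (?v \<bullet> \<omega> 1)) \<le> ereal (\<integral>\<omega>. ln (l \<bullet> \<omega> 1) \<partial>Q)"
      by (simp only: opt'(3)) (simp add: growth_rate_def)
    have mv: "(\<lambda>\<omega>. ?v \<bullet> \<omega> 1) \<in> borel_measurable Q"
      by measurable
    have low: "AE \<omega> in Q. ln (l \<bullet> \<omega> 1) + ln (m / (m + 1)) \<le> ln (?v \<bullet> \<omega> 1)"
      using lnv nonneg
    proof eventually_elim
      case (elim \<omega>)
      then show ?case
        using m by (simp add: divide_right_mono)
    qed
    have ilow: "integrable Q (\<lambda>\<omega>. ln (l \<bullet> \<omega> 1) + ln (m / (m + 1)))"
      using opt'(2) by (intro Bochner_Integration.integrable_add integrable_const)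
    note iv = integrable_ln_of_ereal_expectation_le[OF mv pos ilow low le]
    have bounds: "AE \<omega> in Q. \<bar>m * R \<omega> / (m + R \<omega>)\<bar> \<le> m \<and> \<bar>m / (m + R \<omega>)\<bar> \<le> 1"
      using nonneg
    proof eventually_elim
      case (elim \<omega>)
      have "m * R \<omega> \<le> m * (m + R \<omega>)" "m \<le> m + R \<omega>"
        using elim m by (auto intro!: mult_left_mono)
      then show ?case
        using elim m by (auto simp: divide_le_eq abs_of_nonneg)
    qed
    have i1: "integrable Q (\<lambda>\<omega>. m * R \<omega> / (m + R \<omega>))"
      by (rule integrable_const_bound[where B=m]) (use bounds in auto)
    have i2: "integrable Q (\<lambda>\<omega>. m / (m + R \<omega>))"
      by (rule integrable_const_bound[where B=1]) (use bounds in auto)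
    \<comment> \<open>\<open>ln x \<ge> 1 - 1 / x\<close> at \<open>x = (m + R) / (m + 1)\<close>, multiplied by \<open>m\<close>; all terms are integrable\<close>
    have "(\<integral>\<omega>. m * R \<omega> / (m + R \<omega>) \<partial>Q)
        \<le> (\<integral>\<omega>. m / (m + R \<omega>) + m * (ln (?v \<bullet> \<omega> 1) - ln (l \<bullet> \<omega> 1)) \<partial>Q)"
    proof (rule integral_mono_AE[OF i1])
      show "integrable Q (\<lambda>\<omega>. m / (m + R \<omega>) + m * (ln (?v \<bullet> \<omega> 1) - ln (l \<bullet> \<omega> 1)))"
        by (intro Bochner_Integration.integrable_add i2 integrable_mult_right Bochner_Integration.integrable_diff iv(1) opt'(2))
      show "AE \<omega> in Q. m * R \<omega> / (m + R \<omega>) \<le> m / (m + R \<omega>) + m * (ln (?v \<bullet> \<omega> 1) - ln (l \<bullet> \<omega> 1))"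
        using lnv nonneg
      proof eventually_elim
        case (elim \<omega>)
        have "ln ((m + 1) / (m + R \<omega>)) \<le> (m + 1) / (m + R \<omega>) - 1"
          using elim m by (intro ln_le_minus_one) auto
        moreover have "ln ((m + 1) / (m + R \<omega>)) = - ln ((m + R \<omega>) / (m + 1))"
          using elim m by (simp add: ln_div)
        ultimately have "1 - (m + 1) / (m + R \<omega>) \<le> ln ((m + R \<omega>) / (m + 1))"
          by simp
        then have "m * (1 - (m + 1) / (m + R \<omega>)) \<le> m * ln ((m + R \<omega>) / (m + 1))"
          using m by (intro mult_left_mono) auto
        moreover have "m * (1 - (m + 1) / (m + R \<omega>)) = m * R \<omega> / (m + R \<omega>) - m / (m + R \<omega>)"
        proof -
          have "1 - (m + 1) / (m + R \<omega>) = (R \<omega> - 1) / (m + R \<omega>)"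
            using elim m by (simp add: divide_simps)
          then show ?thesis
            by (simp add: right_diff_distrib diff_divide_distrib)
        qed
        ultimately show ?case
          using elim by simp
      qed
    qed
    also have "\<dots> = (\<integral>\<omega>. m / (m + R \<omega>) \<partial>Q)
        + m * ((\<integral>\<omega>. ln (?v \<bullet> \<omega> 1) \<partial>Q) - (\<integral>\<omega>. ln (l \<bullet> \<omega> 1) \<partial>Q))"
      by (simp only: Bochner_Integration.integral_add[OF i2 integrable_mult_right[OF Bochner_Integration.integrable_diff[OF iv(1) opt'(2)]]]
          Bochner_Integration.integral_diff[OF iv(1) opt'(2)] integral_mult_right_zero)
    also have "\<dots> \<le> (\<integral>\<omega>. m / (m + R \<omega>) \<partial>Q)"
      using iv(2) m by (simp add: mult_nonneg_nonpos)
    also have "\<dots> \<le> (\<integral>\<omega>. 1 \<partial>Q)"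
      by (rule integral_mono_AE[OF i2 integrable_const], use bounds in eventually_elim) linarith
    finally have "(\<integral>\<omega>. m * R \<omega> / (m + R \<omega>) \<partial>Q) \<le> 1"
      by (simp add: prob_space)
    moreover have "AE \<omega> in Q. 0 \<le> m * R \<omega> / (m + R \<omega>)"
      using nonneg by eventually_elim (use m in auto)
    ultimately show ?thesis
      using nn_integral_eq_integral[OF i1] by (simp add: m_def)
  qed
  have "(\<integral>\<^sup>+\<omega>. ennreal (R \<omega>) \<partial>Q)
      = (\<integral>\<^sup>+\<omega>. liminf (\<lambda>n. ennreal (real (Suc n) * R \<omega> / (real (Suc n) + R \<omega>))) \<partial>Q)"
  proof (intro nn_integral_cong_AE, use nonneg in eventually_elim)
    case (elim \<omega>)
    have "(\<lambda>n. R \<omega> / (1 + R \<omega> * inverse (real (Suc n)))) \<longlonglongrightarrow> R \<omega> / (1 + R \<omega> * 0)"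
      by (intro tendsto_intros LIMSEQ_inverse_real_of_nat) auto
    moreover have "R \<omega> / (1 + R \<omega> * inverse (real (Suc n))) = real (Suc n) * R \<omega> / (real (Suc n) + R \<omega>)" for n
    proof -
      have "1 + R \<omega> * inverse (real (Suc n)) = (real (Suc n) + R \<omega>) / real (Suc n)"
        by (simp add: field_simps del: of_nat_Suc)
      then show ?thesis
        by (simp del: of_nat_Suc)
    qed
    ultimately have "(\<lambda>n. real (Suc n) * R \<omega> / (real (Suc n) + R \<omega>)) \<longlonglongrightarrow> R \<omega>"
      by simp
    then have "(\<lambda>n. ennreal (real (Suc n) * R \<omega> / (real (Suc n) + R \<omega>))) \<longlonglongrightarrow> ennreal (R \<omega>)"
      by (rule tendsto_ennrealI)
    then show "ennreal (R \<omega>) = liminf (\<lambda>n. ennreal (real (Suc n) * R \<omega> / (real (Suc n) + R \<omega>)))"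
      by (rule lim_imp_Liminf[symmetric, rotated]) simp
  qed
  also have "\<dots> \<le> liminf (\<lambda>n. \<integral>\<^sup>+\<omega>. ennreal (real (Suc n) * R \<omega> / (real (Suc n) + R \<omega>)) \<partial>Q)"
    by (rule nn_integral_liminf) measurable
  also have "\<dots> \<le> 1"
    using step by (intro Liminf_le) auto
  finally show ?thesis
    by (simp add: R_def)
qed

text \<open>
  The numeraire property says that the measure with density \<open>1 / (l \<bullet> x)\<close> with respect to
  the one-step law of \<open>Q\<close> gives each coordinate mean at most \<open>1\<close>. For coordinate \<open>0\<close>, which is
  constantly \<open>1\<close>, this says that its mass is at most \<open>1\<close>. The mass can be smaller than \<open>1\<close> (when
  \<open>l\<close> puts no weight on coordinate \<open>0\<close>); the deficit is placed at the point
  \<open>(1, 0, \<dots>, 0)\<close>, where it adds nothing to the means of the coordinates \<open>1, \<dots>, d\<close>. The result is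
  the one-step law of a null distribution.
\<close>

lemma dominating_null_law:
  fixes l :: "real ^ ('d::finite option)"
  assumes Q: "iid_law Q" and opt: "log_optimal Q l"
  obtains P where "P \<in> null_laws"
    and "\<And>g. g \<in> borel_measurable borel \<Longrightarrow>
      (\<integral>\<^sup>+\<omega>. g (\<omega> 1) * ennreal (1 / (l \<bullet> \<omega> 1)) \<partial>Q) \<le> (\<integral>\<^sup>+\<omega>. g (\<omega> 1) \<partial>P)"
proof -
  note Q' = iid_lawD[OF Q] and opt' = log_optimalD[OF Q opt]
  interpret Q: prob_space Q by (rule Q'(1))
  have E: "(\<lambda>\<omega>. \<omega> 1) \<in> Q \<rightarrow>\<^sub>M borel"
    by (rule Q'(6)) simp
  define \<nu> where "\<nu> = distr Q borel (\<lambda>\<omega>. \<omega> 1)"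
  have sets_\<nu>[measurable_cong]: "sets \<nu> = sets borel"
    by (simp add: \<nu>_def)
  interpret \<nu>: prob_space \<nu>
    unfolding \<nu>_def by (rule Q.prob_space_distr[OF E])
  define h where "h x = ennreal (1 / (l \<bullet> x))" for x
  have h[measurable]: "h \<in> borel_measurable borel"
    unfolding h_def by measurable
  define e0 :: "real ^ 'd option" where "e0 = axis None 1"
  have e0: "e0 \<in> evecs" "e0 $ Some j = 0" for j
    by (auto simp: e0_def evecs_def axis_def)
  have \<nu>_int: "(\<integral>\<^sup>+x. g x \<partial>\<nu>) = (\<integral>\<^sup>+\<omega>. g (\<omega> 1) \<partial>Q)" if "g \<in> borel_measurable borel" for g
    unfolding \<nu>_def using that by (intro nn_integral_distr[OF E]) simp
  have mass: "(\<integral>\<^sup>+x. h x \<partial>\<nu>) \<le> 1"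
  proof -
    have "(\<integral>\<^sup>+x. h x \<partial>\<nu>) = (\<integral>\<^sup>+\<omega>. ennreal (\<omega> 1 $ None / (l \<bullet> \<omega> 1)) \<partial>Q)"
      unfolding \<nu>_int[OF h]
    proof (intro nn_integral_cong)
      fix \<omega> assume "\<omega> \<in> space Q"
      then have "\<omega> 1 \<in> evecs"
        by (intro coordinate_in_evecs) (auto simp: Q'(3))
      then show "h (\<omega> 1) = ennreal (\<omega> 1 $ None / (l \<bullet> \<omega> 1))"
        by (simp add: h_def evecs_def)
    qed
    also have "\<dots> \<le> 1"
      by (rule numeraire_property[OF Q opt])
    finally show ?thesis .
  qed
  define c where "c = 1 - (\<integral>\<^sup>+x. h x \<partial>\<nu>)"
  \<comment> \<open>A coin decides between the two parts of the law: heads keeps \<open>x\<close> with weight \<open>h x\<close>, tails moves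
    to \<open>e0\<close> with weight \<open>c\<close>.\<close>
  define K where "K = density (count_space (UNIV :: bool set) \<Otimes>\<^sub>M \<nu>) (\<lambda>z. if fst z then h (snd z) else c)"
  define \<mu> where "\<mu> = distr K borel (\<lambda>z. if fst z then snd z else e0)"
  have \<mu>_int: "(\<integral>\<^sup>+x. g x \<partial>\<mu>) = (\<integral>\<^sup>+x. g x * h x \<partial>\<nu>) + g e0 * c"
    if g[measurable]: "g \<in> borel_measurable borel" for g
  proof -
    have "(\<integral>\<^sup>+x. g x \<partial>\<mu>) = (\<integral>\<^sup>+z. g (if fst z then snd z else e0) \<partial>K)"
      unfolding \<mu>_def by (intro nn_integral_distr) (auto simp: K_def)
    also have "\<dots> = (\<integral>\<^sup>+z. (if fst z then h (snd z) else c) * g (if fst z then snd z else e0)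
        \<partial>(count_space UNIV \<Otimes>\<^sub>M \<nu>))"
      unfolding K_def by (intro nn_integral_density) measurable
    also have "\<dots> = (\<integral>\<^sup>+b. \<integral>\<^sup>+x. (if b then h x else c) * g (if b then x else e0) \<partial>\<nu> \<partial>count_space UNIV)"
      by (subst \<nu>.nn_integral_fst[symmetric]) (auto cong: if_cong)
    also have "\<dots> = (\<integral>\<^sup>+x. g x * h x \<partial>\<nu>) + g e0 * c"
      by (simp add: nn_integral_count_space_finite UNIV_bool \<nu>.emeasure_space_1 mult.commute add.commute)
    finally show ?thesis .
  qed
  have sets_\<mu>: "sets \<mu> = sets borel"
    by (simp add: \<mu>_def)
  have prob: "prob_space \<mu>"
  proof (rule prob_spaceI)
    have "emeasure \<mu> (space \<mu>) = (\<integral>\<^sup>+x. 1 \<partial>\<mu>)"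
      by simp
    also have "\<dots> = (\<integral>\<^sup>+x. h x \<partial>\<nu>) + c"
      by (subst \<mu>_int) auto
    also have "\<dots> = 1"
      unfolding c_def using mass by (simp add: diff_add_self_ennreal add.commute)
    finally show "emeasure \<mu> (space \<mu>) = 1" .
  qed
  have ev[measurable]: "evecs \<in> sets (borel :: (real ^ 'd option) measure)"
    by (rule borel_closed[OF closed_evecs])
  have "AE x in \<mu>. x \<in> evecs"
  proof -
    have "(\<integral>\<^sup>+x. indicator (- evecs) x \<partial>\<mu>) = (\<integral>\<^sup>+x. indicator (- evecs) x * h x \<partial>\<nu>)"
      by (subst \<mu>_int) (auto simp: e0)
    also have "\<dots> = (\<integral>\<^sup>+\<omega>. indicator (- evecs) (\<omega> 1) * h (\<omega> 1) \<partial>Q)"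
      by (rule \<nu>_int) simp
    also have "\<dots> = (\<integral>\<^sup>+\<omega>. 0 \<partial>Q)"
    proof (intro nn_integral_cong)
      fix \<omega> assume "\<omega> \<in> space Q"
      then have "\<omega> 1 \<in> evecs"
        by (intro coordinate_in_evecs) (auto simp: Q'(3))
      then show "indicator (- evecs) (\<omega> 1) * h (\<omega> 1) = 0"
        by simp
    qed
    finally have "(\<integral>\<^sup>+x. indicator (- evecs) x \<partial>\<mu>) = 0"
      by simp
    then have "AE x in \<mu>. indicator (- evecs) x = (0 :: ennreal)"
      by (subst (asm) nn_integral_0_iff_AE) (auto simp: \<mu>_def)
    then show ?thesis
      by eventually_elim (auto simp: indicator_def split: if_splits)
  qed
  then obtain P where P: "iid_law P" "distr P borel (\<lambda>\<omega>. \<omega> 1) = \<mu>"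
    using iid_law_exists[OF prob sets_\<mu>] by blast
  have P1: "(\<lambda>\<omega>. \<omega> 1) \<in> P \<rightarrow>\<^sub>M borel"
    by (rule iid_lawD(6)[OF P(1)]) simp
  have P_int: "(\<integral>\<^sup>+\<omega>. g (\<omega> 1) \<partial>P) = (\<integral>\<^sup>+\<omega>. g (\<omega> 1) * h (\<omega> 1) \<partial>Q) + g e0 * c"
    if g[measurable]: "g \<in> borel_measurable borel" for g
  proof -
    have "(\<integral>\<^sup>+\<omega>. g (\<omega> 1) \<partial>P) = (\<integral>\<^sup>+x. g x \<partial>\<mu>)"
      unfolding P(2)[symmetric] by (intro nn_integral_distr[symmetric] P1) simp
    also have "\<dots> = (\<integral>\<^sup>+\<omega>. g (\<omega> 1) * h (\<omega> 1) \<partial>Q) + g e0 * c"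
      by (simp add: \<mu>_int[OF g] \<nu>_int[of "\<lambda>x. g x * h x"])
    finally show ?thesis .
  qed
  show ?thesis
  proof (rule that)
    have "(\<integral>\<^sup>+\<omega>. ennreal (\<omega> 1 $ Some j) \<partial>P) \<le> 1" for j
    proof -
      have "(\<integral>\<^sup>+\<omega>. ennreal (\<omega> 1 $ Some j) \<partial>P) = (\<integral>\<^sup>+\<omega>. ennreal (\<omega> 1 $ Some j) * h (\<omega> 1) \<partial>Q)"
        using P_int[of "\<lambda>x. ennreal (x $ Some j)"] by (simp add: e0 borel_measurable_nth)
      also have "\<dots> = (\<integral>\<^sup>+\<omega>. ennreal (\<omega> 1 $ Some j / (l \<bullet> \<omega> 1)) \<partial>Q)"
      proof (intro nn_integral_cong)
        fix \<omega> assume "\<omega> \<in> space Q"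
        then have "\<omega> 1 \<in> evecs"
          by (intro coordinate_in_evecs) (auto simp: Q'(3))
        then show "ennreal (\<omega> 1 $ Some j) * h (\<omega> 1) = ennreal (\<omega> 1 $ Some j / (l \<bullet> \<omega> 1))"
          by (simp add: h_def evecs_def ennreal_mult'[symmetric])
      qed
      also have "\<dots> \<le> 1"
        by (rule numeraire_property[OF Q opt])
      finally show ?thesis .
    qed
    with P(1) show "P \<in> null_laws"
      by (simp add: null_laws_def)
    show "(\<integral>\<^sup>+\<omega>. g (\<omega> 1) * ennreal (1 / (l \<bullet> \<omega> 1)) \<partial>Q) \<le> (\<integral>\<^sup>+\<omega>. g (\<omega> 1) \<partial>P)"
      if "g \<in> borel_measurable borel" for g
      unfolding P_int[OF that] h_def by simp
  qed
qed

section \<open>Wald's identity and the lower bound\<close>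

lemma filt_mono:
  assumes "m \<le> n"
  shows "sets (filt m) \<subseteq> sets (filt n :: (nat \<Rightarrow> real ^ ('d::finite option)) measure)"
proof -
  have "{(\<lambda>\<omega>. \<omega> i) -` A \<inter> space seq_space | i A. i \<in> {1..m} \<and> A \<in> sets borel}
      \<subseteq> {(\<lambda>\<omega>. \<omega> i) -` A \<inter> space (seq_space :: (nat \<Rightarrow> real ^ 'd option) measure) | i A.
            i \<in> {1..n} \<and> A \<in> sets borel}"
    using assms by fastforce
  then show ?thesis
    unfolding filt_def by (subst (1 2) sets_measure_of) (auto intro!: sigma_sets_mono')
qed

lemma extended_stopping_time_survival:
  assumes "extended_stopping_time \<tau>"
  shows "{\<omega> \<in> space seq_space. enat k < \<tau> \<omega>} \<in> sets (filt k)"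
proof -
  have "{\<omega> \<in> space seq_space. enat k < \<tau> \<omega>}
      = space (filt k) - (\<Union>j\<in>{1..k}. {\<omega> \<in> space seq_space. \<tau> \<omega> = enat j})"
  proof safe
    fix \<omega> j assume "enat k < \<tau> \<omega>" "j \<in> {1..k}" "\<tau> \<omega> = enat j"
    then show False
      by simp
  next
    fix \<omega> assume \<omega>: "\<omega> \<in> space (filt k)"
      "\<omega> \<notin> (\<Union>j\<in>{1..k}. {\<omega> \<in> space seq_space. \<tau> \<omega> = enat j})"
    then have "\<omega> \<in> space seq_space" "1 \<le> \<tau> \<omega>"
      using assms by (auto simp: extended_stopping_time_def space_filt)
    with \<omega>(2) show "enat k < \<tau> \<omega>"
      by (cases "\<tau> \<omega>") (force simp: one_enat_def)+
  qed (auto simp: space_filt)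
  also have "\<dots> \<in> sets (filt k)"
    using assms filt_mono
    by (intro sets.Diff sets.top sets.finite_UN) (fastforce simp: extended_stopping_time_def)+
  finally show ?thesis .
qed

lemma iid_law_AE_all:
  assumes Q: "iid_law Q" and \<phi>: "{x. \<phi> x} \<in> sets borel" and AE: "AE \<omega> in Q. \<phi> (\<omega> 1)"
  shows "AE \<omega> in Q. \<forall>n\<ge>1. \<phi> (\<omega> n)"
proof -
  note Q' = iid_lawD[OF Q]
  have "AE \<omega> in Q. n \<ge> 1 \<longrightarrow> \<phi> (\<omega> n)" for n
  proof (cases "n \<ge> 1")
    case True
    have "AE x in distr Q borel (\<lambda>\<omega>. \<omega> 1). \<phi> x"
      using AE_distr_iff[OF Q'(6)[of 1], of \<phi>] \<phi> AE by simp
    then have "AE x in distr Q borel (\<lambda>\<omega>. \<omega> n). \<phi> x"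
      by (simp only: Q'(5)[OF True])
    then show ?thesis
      using AE_distr_iff[OF Q'(6)[OF True], of \<phi>] \<phi> by simp
  qed auto
  then show ?thesis
    by (simp add: AE_all_countable)
qed

text \<open>
  The stopped sum is written as \<open>\<Sum>k. 1{k < \<tau>} y(E\<^sub>k\<^sub>+\<^sub>1)\<close>; by independence of \<open>{k < \<tau>}\<close> and
  \<open>E\<^sub>k\<^sub>+\<^sub>1\<close> its expectation is \<open>(\<Sum>k. Q(k < \<tau>)) E[y(E\<^sub>1)]\<close>, and the first factor is the expected
  time.
\<close>

lemma wald_identity:
  fixes y :: "real ^ ('d::finite option) \<Rightarrow> real"
  assumes Q: "iid_law Q" and y: "y \<in> borel_measurable borel" "integrable Q (\<lambda>\<omega>. y (\<omega> 1))"
    and \<tau>: "extended_stopping_time \<tau>" and fin: "expected_time Q \<tau> < \<infinity>"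
  defines "S \<equiv> \<lambda>\<omega>. \<Sum>k. indicator {\<omega> \<in> space seq_space. enat k < \<tau> \<omega>} \<omega> * y (\<omega> (Suc k))"
  shows "AE \<omega> in Q. \<tau> \<omega> < \<infinity>" "integrable Q S"
    "(\<integral>\<omega>. S \<omega> \<partial>Q) = enn2real (expected_time Q \<tau>) * (\<integral>\<omega>. y (\<omega> 1) \<partial>Q)"
proof -
  note Q' = iid_lawD[OF Q]
  interpret prob_space Q by (rule Q'(1))
  define G where "G k = {\<omega> \<in> space seq_space. enat k < \<tau> \<omega>}" for k
  have G: "G k \<in> sets (filt k)" for k
    unfolding G_def by (rule extended_stopping_time_survival[OF \<tau>])
  then have GQ: "G k \<in> sets seq_space" "G k \<in> sets Q" for k
    using sets_filt_subset Q'(2) by auto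
  have E: "expected_time Q \<tau> = (\<Sum>k. emeasure Q (G k))"
    using expected_time_eq_suminf[OF Q] GQ by (simp add: G_def)
  then have E': "expected_time Q \<tau> = (\<Sum>k. ennreal (measure Q (G k)))"
    by (simp add: emeasure_eq_measure)
  have sm: "summable (\<lambda>k. measure Q (G k))"
    using fin unfolding E' by (intro summable_suminf_not_top) auto
  have e: "enn2real (expected_time Q \<tau>) = (\<Sum>k. measure Q (G k))"
    unfolding E' using sm by (subst suminf_ennreal2) (auto simp: suminf_nonneg)
  show AE_fin: "AE \<omega> in Q. \<tau> \<omega> < \<infinity>"
  proof (rule AE_I)
    show "{\<omega> \<in> space Q. \<not> \<tau> \<omega> < \<infinity>} \<subseteq> (\<Inter>k. G k)"
      by (auto simp: G_def Q'(3))
    show "(\<Inter>k. G k) \<in> sets Q"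
      using GQ by auto
    have "measure Q (\<Inter>k. G k) \<le> measure Q (G n)" for n
      using GQ by (intro finite_measure_mono) auto
    then have "measure Q (\<Inter>k. G k) \<le> 0"
      by (intro LIMSEQ_le_const[OF summable_LIMSEQ_zero[OF sm]]) auto
    then show "emeasure Q (\<Inter>k. G k) = 0"
      by (simp add: emeasure_eq_measure ennreal_eq_0_iff)
  qed
  have S: "S = (\<lambda>\<omega>. \<Sum>k. indicator (G k) \<omega> * y (\<omega> (Suc k)))"
    by (simp add: S_def G_def)
  note step = iid_next_step[OF Q G y]
  have y': "(\<lambda>x. \<bar>y x\<bar>) \<in> borel_measurable borel" "integrable Q (\<lambda>\<omega>. \<bar>y (\<omega> 1)\<bar>)"
    using y by auto
  have norm_eq: "norm (indicator (G k) \<omega> * y (\<omega> (Suc k))) = indicator (G k) \<omega> * \<bar>y (\<omega> (Suc k))\<bar>" for k \<omega>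
    by (simp add: abs_mult)
  have AE_sm: "AE \<omega> in Q. summable (\<lambda>k. norm (indicator (G k) \<omega> * y (\<omega> (Suc k))))"
    using AE_fin
  proof eventually_elim
    case (elim \<omega>)
    then obtain n where "\<tau> \<omega> = enat n"
      by auto
    then show ?case
      by (intro summable_finite[of "{..<n}"]) (auto simp: G_def indicator_def)
  qed
  have sm': "summable (\<lambda>k. \<integral>\<omega>. norm (indicator (G k) \<omega> * y (\<omega> (Suc k))) \<partial>Q)"
    unfolding norm_eq iid_next_step(2)[OF Q G y'] by (intro summable_mult2 sm)
  show "integrable Q S"
    unfolding S by (rule integrable_suminf[OF step(1) AE_sm sm'])
  have "(\<integral>\<omega>. S \<omega> \<partial>Q) = (\<Sum>k. measure Q (G k) * (\<integral>\<omega>. y (\<omega> 1) \<partial>Q))"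
    unfolding S integral_suminf[OF step(1) AE_sm sm'] step(2) ..
  also have "\<dots> = enn2real (expected_time Q \<tau>) * (\<integral>\<omega>. y (\<omega> 1) \<partial>Q)"
    unfolding e using sm by (rule suminf_mult2[symmetric])
  finally show "(\<integral>\<omega>. S \<omega> \<partial>Q) = enn2real (expected_time Q \<tau>) * (\<integral>\<omega>. y (\<omega> 1) \<partial>Q)" .
qed

text \<open>
  Let \<open>S\<close> be the log-wealth of the optimal portfolio at time \<open>\<tau>\<close>. The dominating null law \<open>P\<close>
  satisfies \<open>\<alpha> \<ge> P(\<tau> < \<infinity>) \<ge> E\<^sub>Q[exp (- S)]\<close>, by summing over the values of \<open>\<tau>\<close> the bound
  for events of the past. Jensen's inequality and Wald's identity bound the right-hand side below by
  \<open>exp (- E\<^sub>Q[S])\<close>, with \<open>E\<^sub>Q[S] = E\<^sub>Q[\<tau>]\<close> times the growth rate. An infinite expected time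
  leaves nothing to prove.
\<close>

lemma expected_stopping_time_lower_bound:
  fixes l :: "real ^ ('d::finite option)"
  assumes Q: "iid_law Q" and opt: "log_optimal Q l" and \<tau>: "extended_stopping_time \<tau>"
    and \<alpha>: "0 < \<alpha>" "\<alpha> < 1"
    and level: "\<And>P. P \<in> null_laws \<Longrightarrow> emeasure P {\<omega> \<in> space P. \<tau> \<omega> < \<infinity>} \<le> ennreal \<alpha>"
    and growth: "growth_rate Q l \<le> ereal u" "u > 0"
  shows "ennreal (1 / u) \<le> expected_time Q \<tau> / ennreal (ln (1 / \<alpha>))"
proof (cases "expected_time Q \<tau> < \<infinity>")
  case False
  then show ?thesis
    by (simp add: ennreal_top_divide less_top[symmetric])
next
  case True
  note Q' = iid_lawD[OF Q] and opt' = log_optimalD[OF Q opt]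
  interpret prob_space Q by (rule Q'(1))
  let ?y = "\<lambda>x. ln (l \<bullet> x)" and ?h = "\<lambda>x. ennreal (1 / (l \<bullet> x))"
  define e where "e = enn2real (expected_time Q \<tau>)"
  define g where "g = (\<integral>\<omega>. ?y (\<omega> 1) \<partial>Q)"
  define S where "S = (\<lambda>\<omega>. \<Sum>k. indicator {\<omega> \<in> space seq_space. enat k < \<tau> \<omega>} \<omega> * ?y (\<omega> (Suc k)))"
  have y: "?y \<in> borel_measurable borel"
    by measurable
  note wald = wald_identity[OF Q y opt'(2) \<tau> True, folded S_def e_def g_def]
  obtain P where P: "P \<in> null_laws"
    and dom: "\<And>g. g \<in> borel_measurable borel \<Longrightarrow>
      (\<integral>\<^sup>+\<omega>. g (\<omega> 1) * ?h (\<omega> 1) \<partial>Q) \<le> (\<integral>\<^sup>+\<omega>. g (\<omega> 1) \<partial>P)"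
    using dominating_null_law[OF Q opt] by blast
  have iid_P: "iid_law P"
    using P by (simp add: null_laws_def)
  note P' = iid_lawD[OF iid_P]
  define A where "A n = {\<omega> \<in> space seq_space. \<tau> \<omega> = enat (Suc n)}" for n
  have A: "A n \<in> sets (filt (Suc n))" for n
    using \<tau> by (auto simp: A_def extended_stopping_time_def)
  then have AQ: "A n \<in> sets seq_space" for n
    using sets_filt_subset by auto
  have h: "?h \<in> borel_measurable borel"
    by measurable
  have pos: "AE \<omega> in Q. \<forall>n\<ge>1. 0 < l \<bullet> \<omega> n"
    by (rule iid_law_AE_all[OF Q _ opt'(1)]) measurable
  have "(\<integral>\<^sup>+\<omega>. ennreal (exp (- S \<omega>)) \<partial>Q)
      = (\<integral>\<^sup>+\<omega>. (\<Sum>n. indicator (A n) \<omega> * (\<Prod>i\<in>{1..Suc n}. ?h (\<omega> i))) \<partial>Q)"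
  proof (rule nn_integral_cong_AE, use pos wald(1) AE_space in eventually_elim)
    case (elim \<omega>)
    then have \<omega>: "\<omega> \<in> space seq_space"
      by (simp add: Q'(3))
    with elim(2) \<tau> obtain m where m: "\<tau> \<omega> = enat (Suc m)"
      by (cases "\<tau> \<omega>") (force simp: extended_stopping_time_def one_enat_def not0_implies_Suc)+
    have "S \<omega> = (\<Sum>k<Suc m. indicator {\<omega> \<in> space seq_space. enat k < \<tau> \<omega>} \<omega> * ?y (\<omega> (Suc k)))"
      unfolding S_def by (rule suminf_finite) (auto simp: m indicator_def)
    also have "\<dots> = (\<Sum>k<Suc m. ?y (\<omega> (Suc k)))"
      using \<omega> by (intro sum.cong) (auto simp: m)
    also have "\<dots> = (\<Sum>i\<in>{1..Suc m}. ?y (\<omega> i))"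
      by (rule sum.reindex_bij_witness[of _ "\<lambda>i. i - 1" Suc]) auto
    finally have "exp (- S \<omega>) = (\<Prod>i\<in>{1..Suc m}. exp (- ?y (\<omega> i)))"
      by (simp only: exp_sum[OF finite_atLeastAtMost, symmetric] sum_negf)
    also have "\<dots> = (\<Prod>i\<in>{1..Suc m}. 1 / (l \<bullet> \<omega> i))"
      using elim(1) by (intro prod.cong) (auto simp: exp_minus inverse_eq_divide)
    finally have "ennreal (exp (- S \<omega>)) = (\<Prod>i\<in>{1..Suc m}. ?h (\<omega> i))"
      using elim(1) by (simp only:) (rule prod_ennreal[symmetric], auto intro: less_imp_le)
    also have "\<dots> = (\<Sum>n\<in>{m}. indicator (A n) \<omega> * (\<Prod>i\<in>{1..Suc n}. ?h (\<omega> i)))"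
      using \<omega> m by (simp add: A_def del: prod.cl_ivl_Suc)
    also have "\<dots> = (\<Sum>n. indicator (A n) \<omega> * (\<Prod>i\<in>{1..Suc n}. ?h (\<omega> i)))"
      by (rule suminf_finite[symmetric]) (auto simp: A_def m)
    finally show ?case .
  qed
  also have "\<dots> = (\<Sum>n. \<integral>\<^sup>+\<omega>. indicator (A n) \<omega> * (\<Prod>i\<in>{1..Suc n}. ?h (\<omega> i)) \<partial>Q)"
  proof (rule nn_integral_suminf)
    fix n
    have "(\<lambda>\<omega>. ?h (\<omega> i)) \<in> borel_measurable Q" if "i \<in> {1..Suc n}" for i
      using measurable_compose[OF Q'(6) h, of i] that by simp
    then have "(\<lambda>\<omega>. \<Prod>i\<in>{1..Suc n}. ?h (\<omega> i)) \<in> borel_measurable Q"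
      by (intro borel_measurable_prod_ennreal)
    moreover have "indicator (A n) \<in> borel_measurable Q"
      using AQ[of n] Q'(2) by (intro borel_measurable_indicator) simp
    ultimately show "(\<lambda>\<omega>. indicator (A n) \<omega> * (\<Prod>i\<in>{1..Suc n}. ?h (\<omega> i))) \<in> borel_measurable Q"
      by (intro borel_measurable_times_ennreal)
  qed
  also have "\<dots> \<le> (\<Sum>n. emeasure P (A n))"
    by (intro suminf_le iid_law_past_domination[OF Q iid_P h dom _ A]) auto
  also have "\<dots> = emeasure P (\<Union>n. A n)"
    using AQ P'(2) by (intro suminf_emeasure) (auto simp: disjoint_family_on_def A_def)
  also have "(\<Union>n. A n) = {\<omega> \<in> space P. \<tau> \<omega> < \<infinity>}"
  proof -
    have "\<exists>n. \<tau> \<omega> = enat (Suc n)" if "\<omega> \<in> space seq_space" "\<tau> \<omega> < \<infinity>" for \<omega>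
      using that \<tau> by (cases "\<tau> \<omega>") (force simp: extended_stopping_time_def one_enat_def not0_implies_Suc)+
    then show ?thesis
      by (fastforce simp: A_def P'(3))
  qed
  also have "emeasure P \<dots> \<le> ennreal \<alpha>"
    by (rule level[OF P])
  finally have le: "(\<integral>\<^sup>+\<omega>. ennreal (exp (- S \<omega>)) \<partial>Q) \<le> ennreal \<alpha>" .
  have S_meas[measurable]: "S \<in> borel_measurable Q"
    using wald(2) by (rule borel_measurable_integrable)
  have int: "integrable Q (\<lambda>\<omega>. exp (- S \<omega>))"
    using le by (intro integrableI_nonneg) (auto simp: less_top[symmetric] top_unique)
  \<comment> \<open>Jensen's inequality: \<open>exp\<close> lies above its tangent at \<open>- e g\<close>, the mean of \<open>- S\<close>.\<close>
  have "exp (- (e * g)) = (\<integral>\<omega>. exp (- (e * g)) * (1 + e * g - S \<omega>) \<partial>Q)"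
    using wald(2,3) by (simp add: Bochner_Integration.integral_diff prob_space)
  also have "\<dots> \<le> (\<integral>\<omega>. exp (- S \<omega>) \<partial>Q)"
  proof (rule integral_mono)
    show "integrable Q (\<lambda>\<omega>. exp (- (e * g)) * (1 + e * g - S \<omega>))"
      using wald(2) by auto
    show "exp (- (e * g)) * (1 + e * g - S \<omega>) \<le> exp (- S \<omega>)" for \<omega>
    proof -
      have "exp (- (e * g)) * (1 + (e * g - S \<omega>)) \<le> exp (- (e * g)) * exp (e * g - S \<omega>)"
        by (intro mult_left_mono exp_ge_add_one_self) auto
      then show ?thesis
        by (simp add: exp_add[symmetric] add_diff_eq)
    qed
  qed (rule int)
  also have "\<dots> \<le> \<alpha>"
    using \<alpha> le by (intro integral_real_bounded) auto
  finally have "- (e * g) \<le> ln \<alpha>"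
    using \<alpha> by (simp add: ln_ge_iff)
  then have "ln (1 / \<alpha>) \<le> e * g"
    using \<alpha> by (simp add: ln_div)
  also have "\<dots> \<le> e * u"
    using growth(1) by (intro mult_left_mono) (auto simp: e_def g_def opt'(3))
  finally have "1 / u \<le> e / ln (1 / \<alpha>)"
    using growth(2) \<alpha> by (simp add: field_simps ln_div)
  moreover have "expected_time Q \<tau> = ennreal e"
    using True by (simp add: e_def less_top[symmetric])
  moreover have "0 < ln (1 / \<alpha>)" "0 \<le> e"
    using \<alpha> by (auto simp: e_def)
  ultimately show ?thesis
    by (simp add: divide_ennreal ennreal_leI)
qed

section \<open>Expected rejection time under sublinear regret\<close>

text \<open>
  \<open>G k\<close> is the event that the walk with steps \<open>y\<close> has stayed below \<open>b\<close> up to time \<open>k\<close>, so the sum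
  of the probabilities is the expected time of first passage. The steps being bounded by \<open>c\<close>, the
  stopped walk never exceeds \<open>b + c\<close>; Wald's identity at bounded times turns this into a bound
  on the partial sums.
\<close>

lemma expected_passage_time_bound:
  fixes y :: "real ^ ('d::finite option) \<Rightarrow> real"
  assumes Q: "iid_law Q" and y: "y \<in> borel_measurable borel" "integrable Q (\<lambda>\<omega>. y (\<omega> 1))"
    and le: "\<And>x. y x \<le> c" and c: "0 \<le> c" and b: "0 \<le> b" and drift: "0 < (\<integral>\<omega>. y (\<omega> 1) \<partial>Q)"
  defines "G \<equiv> \<lambda>k. {\<omega> \<in> space seq_space. \<forall>j\<in>{1..k}. (\<Sum>i\<in>{1..j}. y (\<omega> i)) < b}"
  shows "G k \<in> sets (filt k)"
    and "(\<Sum>k. emeasure Q (G k)) \<le> ennreal ((b + c) / (\<integral>\<omega>. y (\<omega> 1) \<partial>Q))"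
proof -
  note Q' = iid_lawD[OF Q]
  interpret prob_space Q by (rule Q'(1))
  have G: "G k \<in> sets (filt k)" for k
  proof -
    have walk: "(\<lambda>\<omega>. \<Sum>i\<in>{1..j}. y (\<omega> i)) \<in> borel_measurable (filt k)" if "j \<in> {1..k}" for j
      using that by (intro borel_measurable_sum measurable_compose[OF measurable_coordinate_filt y(1)]) auto
    have "G k = {\<omega> \<in> space (filt k). \<forall>j\<in>{1..k}. (\<Sum>i\<in>{1..j}. y (\<omega> i)) < b}"
      by (simp add: G_def space_filt)
    also have "\<dots> \<in> sets (filt k)"
      using walk by (intro sets.sets_Collect_finite_All borel_measurable_less borel_measurable_const) auto
    finally show ?thesis .
  qed
  then show "G k \<in> sets (filt k)" .
  note step = iid_next_step[OF Q G y]
  define T where "T n \<omega> = (\<Sum>k<n. indicator (G k) \<omega> * y (\<omega> (Suc k)))" for n \<omega>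
  \<comment> \<open>\<open>T n\<close> is the walk stopped when it first reaches \<open>b\<close>; before its last step it is at most \<open>b\<close>,
    and that step adds at most \<open>c\<close>.\<close>
  have T_le: "(\<omega> \<in> G n \<longrightarrow> T n \<omega> = (\<Sum>i\<in>{1..n}. y (\<omega> i))) \<and> T n \<omega> \<le> b + c"
    if "\<omega> \<in> space seq_space" for n \<omega>
  proof (induction n)
    case 0
    then show ?case
      using b c by (simp add: T_def)
  next
    case (Suc n)
    show ?case
    proof (cases "\<omega> \<in> G n")
      case True
      have "(\<Sum>i\<in>{1..n}. y (\<omega> i)) \<le> b"
      proof (cases "n = 0")
        case False
        then have "n \<in> {1..n}"
          by auto
        with True show ?thesis
          unfolding G_def by fastforce
      qed (use b in simp)
      with True Suc le[of "\<omega> (Suc n)"] show ?thesis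
        by (auto simp: T_def)
    next
      case False
      then have "\<omega> \<notin> G (Suc n)"
        by (auto simp: G_def)
      with False Suc show ?thesis
        by (auto simp: T_def)
    qed
  qed
  have partial: "(\<Sum>k<n. measure Q (G k)) \<le> (b + c) / (\<integral>\<omega>. y (\<omega> 1) \<partial>Q)" for n
  proof -
    have "(\<Sum>k<n. measure Q (G k)) * (\<integral>\<omega>. y (\<omega> 1) \<partial>Q) = (\<integral>\<omega>. T n \<omega> \<partial>Q)"
      unfolding T_def by (simp only: Bochner_Integration.integral_sum[OF step(1)] step(2) sum_distrib_right)
    also have "\<dots> \<le> (\<integral>\<omega>. b + c \<partial>Q)"
    proof (rule integral_mono)
      show "integrable Q (T n)"
        unfolding T_def by (intro Bochner_Integration.integrable_sum step(1))
    qed (use T_le in \<open>auto simp: Q'(3)\<close>)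
    also have "\<dots> = b + c"
      by (simp add: prob_space)
    finally show ?thesis
      using drift by (simp add: pos_le_divide_eq)
  qed
  have "(\<Sum>k<n. emeasure Q (G k)) \<le> ennreal ((b + c) / (\<integral>\<omega>. y (\<omega> 1) \<partial>Q))" for n
    using partial[of n] by (simp add: emeasure_eq_measure sum_ennreal ennreal_leI)
  then show "(\<Sum>k. emeasure Q (G k)) \<le> ennreal ((b + c) / (\<integral>\<omega>. y (\<omega> 1) \<partial>Q))"
    by (intro suminf_le_const) auto
qed

text \<open>
  A value \<open>w \<le> 0\<close> is excluded because \<open>elog w = -\<infinity>\<close> would make the regret infinite.
\<close>

lemma regret_bound_wealth:
  fixes l :: "real ^ ('d::finite option)"
  assumes regret: "(SUP l\<in>prob_simplex. \<Sum>i=1..n. elog (l \<bullet> \<omega> i)) - elog w \<le> ereal r"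
    and l: "l \<in> prob_simplex" and pos: "\<And>i. i \<in> {1..n} \<Longrightarrow> 0 < l \<bullet> \<omega> i"
  shows "0 < w" "(\<Sum>i=1..n. ln (l \<bullet> \<omega> i)) - r \<le> ln w"
proof -
  let ?M = "SUP l\<in>prob_simplex. \<Sum>i=1..n. elog (l \<bullet> \<omega> i)"
  have "(\<Sum>i=1..n. elog (l \<bullet> \<omega> i)) = (\<Sum>i=1..n. ereal (ln (l \<bullet> \<omega> i)))"
    by (intro sum.cong) (auto simp: elog_def pos)
  then have "(\<Sum>i=1..n. elog (l \<bullet> \<omega> i)) = ereal (\<Sum>i=1..n. ln (l \<bullet> \<omega> i))"
    by simp
  then have M: "ereal (\<Sum>i=1..n. ln (l \<bullet> \<omega> i)) \<le> ?M"
    using SUP_upper[OF l, of "\<lambda>l. \<Sum>i=1..n. elog (l \<bullet> \<omega> i)"] by simp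
  show w: "0 < w"
  proof (rule ccontr)
    assume "\<not> 0 < w"
    then have "elog w = - \<infinity>"
      by (simp add: elog_def)
    with regret M show False
      by (cases ?M) auto
  qed
  from regret M w show "(\<Sum>i=1..n. ln (l \<bullet> \<omega> i)) - r \<le> ln w"
    by (cases ?M) (auto simp: elog_def)
qed

text \<open>
  By the regret bound, \<open>ln (W n)\<close> is at least the log-wealth of \<open>l\<close> minus \<open>\<delta> n + K\<close>. Charging \<open>\<delta>\<close>
  to every step and \<open>K\<close> to the threshold, rejection happens no later than the first passage of a
  random walk above \<open>ln (1 / \<alpha>) + K\<close>.
\<close>

lemma rejection_time_le_passage_time:
  fixes l :: "real ^ ('d::finite option)"
  assumes regret: "\<And>n. n \<ge> 1 \<Longrightarrow>
      (SUP l\<in>prob_simplex. \<Sum>i=1..n. elog (l \<bullet> \<omega> i)) - elog (W n \<omega>) \<le> ereal (r n)"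
    and l: "l \<in> prob_simplex" and pos: "\<And>i. i \<ge> 1 \<Longrightarrow> 0 < l \<bullet> \<omega> i"
    and r: "\<And>n. r n \<le> \<delta> * real n + K" and y: "\<And>x. y x \<le> ln (l \<bullet> x) - \<delta>" and \<alpha>: "0 < \<alpha>"
  shows "ennreal_of_enat (rejection_time W \<alpha> \<omega>)
    \<le> (\<Sum>k. if \<forall>j\<in>{1..k}. (\<Sum>i\<in>{1..j}. y (\<omega> i)) < ln (1 / \<alpha>) + K then 1 else 0)"
  unfolding ennreal_of_enat_eq_suminf
proof (rule suminf_le)
  fix k
  have reject: "rejection_time W \<alpha> \<omega> \<le> enat j"
    if j: "j \<ge> 1" "ln (1 / \<alpha>) + K \<le> (\<Sum>i\<in>{1..j}. y (\<omega> i))" for j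
  proof -
    have w: "0 < W j \<omega>" "(\<Sum>i=1..j. ln (l \<bullet> \<omega> i)) - r j \<le> ln (W j \<omega>)"
      using regret_bound_wealth[OF regret[OF j(1)] l] pos by auto
    have "(\<Sum>i\<in>{1..j}. y (\<omega> i)) \<le> (\<Sum>i=1..j. ln (l \<bullet> \<omega> i) - \<delta>)"
      by (intro sum_mono y)
    also have "\<dots> = (\<Sum>i=1..j. ln (l \<bullet> \<omega> i)) - \<delta> * real j"
      by (simp add: sum_subtractf)
    finally have "ln (1 / \<alpha>) \<le> ln (W j \<omega>)"
      using j(2) w(2) r[of j] by linarith
    then have "1 / \<alpha> \<le> W j \<omega>"
      using w(1) \<alpha> by (subst (asm) ln_le_cancel_iff) auto
    then show ?thesis
      unfolding rejection_time_def using j(1) by (intro Inf_lower) auto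
  qed
  show "(if enat k < rejection_time W \<alpha> \<omega> then 1 else 0)
      \<le> (if \<forall>j\<in>{1..k}. (\<Sum>i\<in>{1..j}. y (\<omega> i)) < ln (1 / \<alpha>) + K then 1 else 0 :: ennreal)"
  proof (cases "\<forall>j\<in>{1..k}. (\<Sum>i\<in>{1..j}. y (\<omega> i)) < ln (1 / \<alpha>) + K")
    case False
    then obtain j where "j \<in> {1..k}" "ln (1 / \<alpha>) + K \<le> (\<Sum>i\<in>{1..j}. y (\<omega> i))"
      by (auto simp: not_less)
    with reject[of j] have "rejection_time W \<alpha> \<omega> \<le> enat k"
      by (meson atLeastAtMost_iff enat_ord_simps(1) order_trans)
    then show ?thesis
      by (simp add: not_less[symmetric])
  qed auto
qed auto

text \<open>
  Where \<open>x > g + A\<close>, the excess \<open>u = x - g\<close> satisfies \<open>A u \<le> u\<^sup>2 \<le> u\<^sup>s\<close>.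
\<close>

lemma truncation_error_le_moment:
  fixes x g A s :: real
  assumes "1 \<le> A" "2 < s"
  shows "x - \<bar>x - g\<bar> powr s / A \<le> min x (g + A)"
proof (cases "x \<le> g + A")
  case True
  then show ?thesis
    using assms by simp
next
  case False
  define u where "u = x - g"
  have u: "A < u" "1 \<le> u"
    using False assms by (auto simp: u_def)
  have "u * A \<le> u * u"
    using u by (intro mult_left_mono) auto
  also have "\<dots> = u powr 2"
    using u by (simp add: powr_numeral power2_eq_square)
  also have "\<dots> \<le> u powr s"
    using u assms by (intro powr_mono) auto
  finally have "u \<le> u powr s / A"
    using assms by (simp add: pos_le_divide_eq)
  then show ?thesis
    using False u assms by (auto simp: u_def)
qed

text \<open>
  The walk has steps \<open>min (ln (l \<bullet> E)) (g + A) - \<epsilon> \<gamma>\<close>, where \<open>g\<close> is the growth rate of \<open>Q\<close>.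
  The truncation at \<open>g + A\<close> bounds the overshoot and costs at most \<open>C / A \<le> \<epsilon> \<gamma>\<close> of the drift,
  which stays at least \<open>(1 - 2\<epsilon>) g\<close>. The truncation is taken relative to \<open>g\<close> since \<open>g\<close> need not
  be bounded over the class of alternatives: in the quotient
  \<open>(ln (1 / \<alpha>) + K + g + A) / ((1 - 2\<epsilon>) g)\<close> it cancels, up to the constant \<open>1 / (1 - 2\<epsilon>)\<close>, and the
  final bound depends on \<open>Q\<close> through \<open>\<gamma>\<close> and \<open>C\<close> only.
\<close>

lemma expected_rejection_time_bound:
  fixes l :: "real ^ ('d::finite option)"
  assumes Q: "iid_law Q" and opt: "log_optimal Q l"
    and moment: "(\<integral>\<^sup>+\<omega>. abs_powr (elog (l \<bullet> \<omega> 1) - growth_rate Q l) s \<partial>Q) \<le> ennreal C"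
    and s: "2 < s" and C: "0 \<le> C" and low: "ereal \<gamma> \<le> growth_rate Q l" "0 < \<gamma>"
    and regret: "\<And>n \<omega>. n \<ge> 1 \<Longrightarrow> \<omega> \<in> space seq_space \<Longrightarrow>
      (SUP l\<in>prob_simplex. \<Sum>i=1..n. elog (l \<bullet> \<omega> i)) - elog (W n \<omega>) \<le> ereal (r n)"
    and r: "\<And>n. r n \<le> \<epsilon> * \<gamma> * real n + K" and K: "0 \<le> K"
    and \<epsilon>: "0 < \<epsilon>" "2 * \<epsilon> < 1" and A: "1 \<le> A" "C / A \<le> \<epsilon> * \<gamma>" and \<alpha>: "0 < \<alpha>" "\<alpha> < 1"
  shows "expected_time Q (rejection_time W \<alpha>)
    \<le> ennreal ((ln (1 / \<alpha>) + K + A) / ((1 - 2 * \<epsilon>) * \<gamma>) + 1 / (1 - 2 * \<epsilon>))"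
proof -
  note Q' = iid_lawD[OF Q] and opt' = log_optimalD[OF Q opt]
  interpret prob_space Q by (rule Q'(1))
  have l: "l \<in> prob_simplex"
    using opt by (simp add: log_optimal_def)
  have E[measurable]: "(\<lambda>\<omega>. \<omega> 1) \<in> Q \<rightarrow>\<^sub>M borel"
    by (rule Q'(6)) simp
  define X where "X \<omega> = ln (l \<bullet> \<omega> 1)" for \<omega> :: "nat \<Rightarrow> real ^ 'd option"
  define g where "g = (\<integral>\<omega>. X \<omega> \<partial>Q)"
  have X: "integrable Q X"
    using opt'(2) by (simp add: X_def[abs_def])
  have [measurable]: "X \<in> borel_measurable Q"
    using X by (rule borel_measurable_integrable)
  have gr: "growth_rate Q l = ereal g"
    by (simp add: opt'(3) g_def X_def)
  have g: "\<gamma> \<le> g" "0 < g"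
    using low by (auto simp: gr)
  have "(\<integral>\<^sup>+\<omega>. ennreal (\<bar>X \<omega> - g\<bar> powr s) \<partial>Q) = (\<integral>\<^sup>+\<omega>. abs_powr (elog (l \<bullet> \<omega> 1) - growth_rate Q l) s \<partial>Q)"
    by (intro nn_integral_cong_AE, use opt'(1) in eventually_elim)
      (simp add: abs_powr_def elog_def gr X_def)
  also note moment
  finally have mom: "(\<integral>\<^sup>+\<omega>. ennreal (\<bar>X \<omega> - g\<bar> powr s) \<partial>Q) \<le> ennreal C" .
  have mom_int: "integrable Q (\<lambda>\<omega>. \<bar>X \<omega> - g\<bar> powr s)"
    using mom by (intro integrableI_nonneg) (auto simp: less_top[symmetric] top_unique)
  have mom_le: "(\<integral>\<omega>. \<bar>X \<omega> - g\<bar> powr s \<partial>Q) \<le> C"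
    using C mom by (intro integral_real_bounded) auto
  define y where "y x = min (ln (l \<bullet> x)) (g + A) - \<epsilon> * \<gamma>" for x
  have y: "y \<in> borel_measurable borel"
    unfolding y_def by measurable
  have y1: "y (\<omega> 1) = min (X \<omega>) (g + A) - \<epsilon> * \<gamma>" for \<omega>
    by (simp add: y_def X_def)
  have minX: "integrable Q (\<lambda>\<omega>. min (X \<omega>) (g + A))"
    using X by (intro integrable_min integrable_const)
  have y_int: "integrable Q (\<lambda>\<omega>. y (\<omega> 1))"
    unfolding y1 using minX by (intro Bochner_Integration.integrable_diff integrable_const)
  have "g - C / A \<le> g - (\<integral>\<omega>. \<bar>X \<omega> - g\<bar> powr s \<partial>Q) / A"
    using mom_le A by (simp add: divide_right_mono)
  also have "\<dots> = (\<integral>\<omega>. X \<omega> - \<bar>X \<omega> - g\<bar> powr s / A \<partial>Q)"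
    using X mom_int by (simp add: Bochner_Integration.integral_diff g_def)
  also have "\<dots> \<le> (\<integral>\<omega>. min (X \<omega>) (g + A) \<partial>Q)"
    using X mom_int minX A(1) s
    by (intro integral_mono truncation_error_le_moment) auto
  finally have "g - C / A - \<epsilon> * \<gamma> \<le> (\<integral>\<omega>. y (\<omega> 1) \<partial>Q)"
    unfolding y1 using minX by (simp add: Bochner_Integration.integral_diff prob_space)
  moreover have "\<epsilon> * \<gamma> \<le> \<epsilon> * g"
    using g \<epsilon> by (intro mult_left_mono) auto
  ultimately have drift: "(1 - 2 * \<epsilon>) * g \<le> (\<integral>\<omega>. y (\<omega> 1) \<partial>Q)"
    using A(2) by (simp add: algebra_simps)
  have pos_drift: "0 < (1 - 2 * \<epsilon>) * g"
    using g \<epsilon> by simp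
  define b where "b = ln (1 / \<alpha>) + K"
  have b: "0 \<le> b"
    using \<alpha> K by (simp add: b_def)
  have y_le: "y x \<le> g + A" for x
    using \<epsilon> low(2) by (simp add: y_def min_def) (smt (verit) mult_pos_pos)
  let ?G = "\<lambda>k. {\<omega> \<in> space seq_space. \<forall>j\<in>{1..k}. (\<Sum>i\<in>{1..j}. y (\<omega> i)) < b}"
  have "0 \<le> g + A"
    using g A by simp
  note passage = expected_passage_time_bound[OF Q y y_int y_le this b less_le_trans[OF pos_drift drift]]
  have GQ: "?G k \<in> sets Q" for k
    using passage(1)[of k] sets_filt_subset Q'(2) by blast
  have pos: "AE \<omega> in Q. \<forall>n\<ge>1. 0 < l \<bullet> \<omega> n"
    by (rule iid_law_AE_all[OF Q _ opt'(1)]) measurable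
  have "expected_time Q (rejection_time W \<alpha>) \<le> (\<integral>\<^sup>+\<omega>. (\<Sum>k. indicator (?G k) \<omega>) \<partial>Q)"
    unfolding expected_time_def
  proof (rule nn_integral_mono_AE, use pos AE_space in eventually_elim)
    case (elim \<omega>)
    then have \<omega>: "\<omega> \<in> space seq_space"
      by (simp add: Q'(3))
    have "ennreal_of_enat (rejection_time W \<alpha> \<omega>)
        \<le> (\<Sum>k. if \<forall>j\<in>{1..k}. (\<Sum>i\<in>{1..j}. y (\<omega> i)) < ln (1 / \<alpha>) + K then 1 else 0)"
    proof (rule rejection_time_le_passage_time[where r = r and \<delta> = "\<epsilon> * \<gamma>"])
      show "(SUP l\<in>prob_simplex. \<Sum>i=1..n. elog (l \<bullet> \<omega> i)) - elog (W n \<omega>) \<le> ereal (r n)" if "n \<ge> 1" for n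
        by (rule regret[OF that \<omega>])
      show "0 < l \<bullet> \<omega> i" if "i \<ge> 1" for i
        using elim that by blast
      show "y x \<le> ln (l \<bullet> x) - \<epsilon> * \<gamma>" for x
        by (simp add: y_def)
    qed (fact l r \<alpha>)+
    also have "\<dots> = (\<Sum>k. indicator (?G k) \<omega>)"
      using \<omega> by (intro suminf_cong) (simp add: indicator_def b_def)
    finally show ?case .
  qed
  also have "\<dots> = (\<Sum>k. emeasure Q (?G k))"
    using GQ by (subst nn_integral_suminf) (auto intro!: borel_measurable_indicator simp del: atLeastAtMost_iff)
  also have "\<dots> \<le> ennreal ((b + (g + A)) / (\<integral>\<omega>. y (\<omega> 1) \<partial>Q))"
    by (rule passage(2))
  also have "\<dots> \<le> ennreal ((ln (1 / \<alpha>) + K + A) / ((1 - 2 * \<epsilon>) * \<gamma>) + 1 / (1 - 2 * \<epsilon>))"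
  proof (rule ennreal_leI)
    have "(b + (g + A)) / (\<integral>\<omega>. y (\<omega> 1) \<partial>Q) \<le> (b + (g + A)) / ((1 - 2 * \<epsilon>) * g)"
      using drift less_le_trans[OF pos_drift drift] b g A pos_drift by (intro divide_left_mono mult_pos_pos[OF _ pos_drift]) auto
    also have "\<dots> = (b + A) / ((1 - 2 * \<epsilon>) * g) + 1 / (1 - 2 * \<epsilon>)"
    proof -
      have "b + (g + A) = (b + A) + g"
        by simp
      then have "(b + (g + A)) / ((1 - 2 * \<epsilon>) * g) = (b + A) / ((1 - 2 * \<epsilon>) * g) + g / ((1 - 2 * \<epsilon>) * g)"
        by (simp only: add_divide_distrib)
      then show ?thesis
        using g by simp
    qed
    also have "\<dots> \<le> (b + A) / ((1 - 2 * \<epsilon>) * \<gamma>) + 1 / (1 - 2 * \<epsilon>)"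
      using g low(2) \<epsilon> b A by (intro add_right_mono divide_left_mono mult_left_mono mult_pos_pos) auto
    finally show "(b + (g + A)) / (\<integral>\<omega>. y (\<omega> 1) \<partial>Q)
        \<le> (ln (1 / \<alpha>) + K + A) / ((1 - 2 * \<epsilon>) * \<gamma>) + 1 / (1 - 2 * \<epsilon>)"
      by (simp add: b_def)
  qed
  finally show ?thesis .
qed

lemma sublinear_le_affine:
  fixes r :: "nat \<Rightarrow> real"
  assumes "r \<in> o(\<lambda>n. real n)" "0 < \<delta>"
  obtains K where "0 \<le> K" "\<And>n. r n \<le> \<delta> * real n + K"
proof -
  have "eventually (\<lambda>n. norm (r n) \<le> \<delta> * norm (real n)) at_top"
    using assms by (intro landau_o.smallD)
  then obtain N where N: "\<And>n. n \<ge> N \<Longrightarrow> \<bar>r n\<bar> \<le> \<delta> * real n"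
    by (auto simp: eventually_at_top_linorder)
  show ?thesis
  proof (rule that)
    show "0 \<le> (\<Sum>i<N. \<bar>r i\<bar>)"
      by (intro sum_nonneg) auto
    show "r n \<le> \<delta> * real n + (\<Sum>i<N. \<bar>r i\<bar>)" for n
    proof (cases "n \<ge> N")
      case True
      with N[of n] show ?thesis
        using sum_nonneg[of "{..<N}" "\<lambda>i. \<bar>r i\<bar>"] by (smt (verit) abs_ge_zero)
    next
      case False
      then have "\<bar>r n\<bar> \<le> (\<Sum>i<N. \<bar>r i\<bar>)"
        by (intro member_le_sum) auto
      then show ?thesis
        using assms(2) by (smt (verit) mult_nonneg_nonneg of_nat_0_le_iff)
    qed
  qed
qed

section \<open>Asymptotic optimality\<close>

text \<open>
  The upper bound is obtained for each fixed \<open>\<epsilon>\<close> by dividing the previous bound by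
  \<open>ln (1 / \<alpha>) \<rightarrow> \<infinity>\<close>, and then letting \<open>\<epsilon> \<rightarrow> 0\<close>.
\<close>

theorem theorem5p3:
  fixes \<Q> :: "(nat \<Rightarrow> real ^ ('d::finite option)) measure set"
    and lam :: "(nat \<Rightarrow> real ^ ('d option)) measure \<Rightarrow> real ^ ('d option)"
    and s l_low :: real
  assumes alternatives: "\<And>Q. Q \<in> \<Q> \<Longrightarrow> iid_law Q"
    and optimal: "\<And>Q. Q \<in> \<Q> \<Longrightarrow> log_optimal Q (lam Q)"
    and s: "s > 2"
    and moment: "(SUP Q\<in>\<Q>. \<integral>\<^sup>+\<omega>. abs_powr (elog (lam Q \<bullet> \<omega> 1) - growth_rate Q (lam Q)) s \<partial>Q) < \<infinity>"
    and l_low: "l_low > 0" "(INF Q\<in>\<Q>. growth_rate Q (lam Q)) \<ge> ereal l_low"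
  shows "(\<forall>W. e_process W \<and> sublinear_portfolio_regret W \<longrightarrow>
            Limsup (at_right 0) (\<lambda>\<alpha>::real.
              SUP Q\<in>\<Q>. expected_time Q (rejection_time W \<alpha>) / ennreal (ln (1 / \<alpha>)))
            \<le> ennreal (1 / l_low)) \<and>
         (\<forall>l_up::real. (SUP Q\<in>\<Q>. growth_rate Q (lam Q)) \<le> ereal l_up \<longrightarrow>
            (\<forall>\<alpha>\<in>{0<..<1}. \<forall>\<tau>.
               extended_stopping_time \<tau> \<and>
               (SUP P\<in>null_laws. emeasure P {\<omega> \<in> space P. \<tau> \<omega> < \<infinity>}) \<le> ennreal \<alpha> \<longrightarrow>
               (\<forall>Q\<in>\<Q>. expected_time Q \<tau> / ennreal (ln (1 / \<alpha>)) \<ge> ennreal (1 / l_up))))"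
proof (intro conjI allI impI ballI)
  fix W :: "nat \<Rightarrow> (nat \<Rightarrow> real ^ 'd option) \<Rightarrow> real"
  assume "e_process W \<and> sublinear_portfolio_regret W"
  then obtain r where r: "r \<in> o(\<lambda>n. real n)"
    and regret: "\<And>n \<omega>. n \<ge> 1 \<Longrightarrow> \<omega> \<in> space seq_space \<Longrightarrow>
      (SUP l\<in>prob_simplex. \<Sum>i=1..n. elog (l \<bullet> \<omega> i)) - elog (W n \<omega>) \<le> ereal (r n)"
    unfolding sublinear_portfolio_regret_def by blast
  let ?m = "\<lambda>Q. \<integral>\<^sup>+\<omega>. abs_powr (elog (lam Q \<bullet> \<omega> 1) - growth_rate Q (lam Q)) s \<partial>Q"
  let ?F = "\<lambda>\<alpha>::real. SUP Q\<in>\<Q>. expected_time Q (rejection_time W \<alpha>) / ennreal (ln (1 / \<alpha>))"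
  define C where "C = enn2real (SUP Q\<in>\<Q>. ?m Q)"
  have C: "0 \<le> C" "?m Q \<le> ennreal C" if "Q \<in> \<Q>" for Q
    using SUP_upper[OF that, of ?m] moment by (auto simp: C_def)
  have C0: "0 \<le> C"
    by (simp add: C_def)
  have eps: "Limsup (at_right 0) ?F \<le> ennreal (1 / ((1 - 2 * \<epsilon>) * l_low))"
    if \<epsilon>: "0 < \<epsilon>" "2 * \<epsilon> < 1" for \<epsilon>
  proof -
    obtain K where K: "0 \<le> K" "\<And>n. r n \<le> \<epsilon> * l_low * real n + K"
      using sublinear_le_affine[OF r, of "\<epsilon> * l_low"] \<epsilon> l_low by auto
    define A where "A = max 1 (C / (\<epsilon> * l_low))"
    have "C / (\<epsilon> * l_low) \<le> A"
      by (simp add: A_def)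
    then have "C \<le> \<epsilon> * l_low * A"
      using \<epsilon> l_low by (simp add: pos_divide_le_eq mult.commute)
    moreover have "1 \<le> A"
      by (simp add: A_def)
    ultimately have A: "1 \<le> A" "C / A \<le> \<epsilon> * l_low"
      by (simp_all add: pos_divide_le_eq)
    let ?B = "\<lambda>\<alpha>. 1 / ((1 - 2 * \<epsilon>) * l_low)
      + ((K + A) / ((1 - 2 * \<epsilon>) * l_low) + 1 / (1 - 2 * \<epsilon>)) / ln (1 / \<alpha>)"
    have "?F \<alpha> \<le> ennreal (?B \<alpha>)" if \<alpha>: "0 < \<alpha>" "\<alpha> < 1" for \<alpha>
    proof (rule SUP_least)
      fix Q assume Q: "Q \<in> \<Q>"
      have L: "0 < ln (1 / \<alpha>)"
        using \<alpha> by simp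
      have "ereal l_low \<le> growth_rate Q (lam Q)"
        using l_low(2) Q by (simp add: le_INF_iff)
      then have "expected_time Q (rejection_time W \<alpha>)
          \<le> ennreal ((ln (1 / \<alpha>) + K + A) / ((1 - 2 * \<epsilon>) * l_low) + 1 / (1 - 2 * \<epsilon>))"
        by (rule expected_rejection_time_bound[OF alternatives[OF Q] optimal[OF Q] C(2)[OF Q] s C0 _
              l_low(1) regret K(2,1) \<epsilon> A \<alpha>])
      then have "expected_time Q (rejection_time W \<alpha>) / ennreal (ln (1 / \<alpha>))
          \<le> ennreal ((ln (1 / \<alpha>) + K + A) / ((1 - 2 * \<epsilon>) * l_low) + 1 / (1 - 2 * \<epsilon>)) / ennreal (ln (1 / \<alpha>))"
        by (rule divide_right_mono_ennreal)
      also have "\<dots> = ennreal (((ln (1 / \<alpha>) + K + A) / ((1 - 2 * \<epsilon>) * l_low) + 1 / (1 - 2 * \<epsilon>)) / ln (1 / \<alpha>))"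
        using L K A \<epsilon> l_low by (intro divide_ennreal) auto
      also have "((ln (1 / \<alpha>) + K + A) / ((1 - 2 * \<epsilon>) * l_low) + 1 / (1 - 2 * \<epsilon>)) / ln (1 / \<alpha>) = ?B \<alpha>"
        using L by (simp only: add_divide_distrib add.assoc) simp
      finally show "expected_time Q (rejection_time W \<alpha>) / ennreal (ln (1 / \<alpha>)) \<le> ennreal (?B \<alpha>)" .
    qed
    then have "eventually (\<lambda>\<alpha>. ?F \<alpha> \<le> ennreal (?B \<alpha>)) (at_right 0)"
      unfolding eventually_at_right_field by (intro exI[of _ 1]) auto
    then have "Limsup (at_right 0) ?F \<le> Limsup (at_right 0) (\<lambda>\<alpha>. ennreal (?B \<alpha>))"
      by (rule Limsup_mono)
    also have "\<dots> = ennreal (1 / ((1 - 2 * \<epsilon>) * l_low))"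
    proof (rule lim_imp_Limsup)
      have "filterlim (\<lambda>\<alpha>::real. ln (1 / \<alpha>)) at_top (at_right 0)"
        using filterlim_compose[OF ln_at_top filterlim_inverse_at_top_right] by (simp add: inverse_eq_divide)
      then have "(?B \<longlongrightarrow> 1 / ((1 - 2 * \<epsilon>) * l_low) + 0) (at_right 0)"
        by (intro tendsto_add tendsto_const tendsto_divide_0[OF tendsto_const] filterlim_at_top_imp_at_infinity)
      then show "((\<lambda>\<alpha>. ennreal (?B \<alpha>)) \<longlongrightarrow> ennreal (1 / ((1 - 2 * \<epsilon>) * l_low))) (at_right 0)"
        by (intro tendsto_ennrealI) simp
    qed simp
    finally show ?thesis .
  qed
  have "((\<lambda>\<epsilon>. 1 / ((1 - 2 * \<epsilon>) * l_low)) \<longlongrightarrow> 1 / ((1 - 2 * 0) * l_low)) (at_right 0)"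
    using l_low by (intro tendsto_intros) auto
  then have "((\<lambda>\<epsilon>. ennreal (1 / ((1 - 2 * \<epsilon>) * l_low))) \<longlongrightarrow> ennreal (1 / l_low)) (at_right 0)"
    by (intro tendsto_ennrealI) simp
  moreover have "eventually (\<lambda>\<epsilon>. Limsup (at_right 0) ?F \<le> ennreal (1 / ((1 - 2 * \<epsilon>) * l_low))) (at_right 0)"
    unfolding eventually_at_right_field using eps by (intro exI[of _ "1 / 2"]) auto
  ultimately show "Limsup (at_right 0) ?F \<le> ennreal (1 / l_low)"
    by (intro tendsto_lowerbound[of _ _ "at_right (0::real)"]) auto
next
  fix l_up \<alpha> :: real and \<tau> :: "(nat \<Rightarrow> real ^ 'd option) \<Rightarrow> enat" and Q
  assume up: "(SUP Q\<in>\<Q>. growth_rate Q (lam Q)) \<le> ereal l_up" and \<alpha>: "\<alpha> \<in> {0<..<1}"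
    and \<tau>: "extended_stopping_time \<tau> \<and>
      (SUP P\<in>null_laws. emeasure P {\<omega> \<in> space P. \<tau> \<omega> < \<infinity>}) \<le> ennreal \<alpha>"
    and Q: "Q \<in> \<Q>"
  have growth: "growth_rate Q (lam Q) \<le> ereal l_up"
    using up Q by (simp add: SUP_le_iff)
  have "ereal l_low \<le> growth_rate Q (lam Q)"
    using l_low(2) Q by (simp add: le_INF_iff)
  also note growth
  finally have "0 < l_up"
    using l_low(1) by simp
  moreover have "emeasure P {\<omega> \<in> space P. \<tau> \<omega> < \<infinity>} \<le> ennreal \<alpha>" if "P \<in> null_laws" for P
    using \<tau> that by (simp add: SUP_le_iff)
  ultimately show "ennreal (1 / l_up) \<le> expected_time Q \<tau> / ennreal (ln (1 / \<alpha>))"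
    using \<tau> \<alpha> growth
    by (intro expected_stopping_time_lower_bound[OF alternatives[OF Q] optimal[OF Q]]) auto
qed

end
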